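(* Let $0<\alpha,\beta<\infty$, let $\varphi,\psi\in S(\mathbb{D})$ and $g,h\in H(\mathbb{D})$. If both $C^g_\varphi$ and $C^h_\psi$ are bounded from $\mathcal{B}^\alpha$ to $\mathcal{B}^\beta$, then the following statements are equivalent. (i) $C^g_\varphi-C^h_\psi:\mathcal{B}^\alpha\to\mathcal{B}^\beta$ is compact. (ii) $\lim_{r\to1}\sup_{|\varphi(z)|>r}|D_{\varphi,g}(z)|\rho(z)=\lim_{r\to1}\sup_{|\psi(z)|>r}|D_{\psi,h}(z)|\rho(z)=\lim_{r\to1}\sup_{|\varphi(z)|>r,\ |\psi(z)|>r}|D_{\varphi,g}(z)-D_{\psi,h}(z)|=0.$ (iii) $\limsup_{|a|\to1}\|(C^g_\varphi-C^h_\psi)f_a\|_{\mathcal{B}^\beta}=\limsup_{|a|\to1}\|(C^g_\varphi-C^h_\psi)g_a\|_{\mathcal{B}^\beta}=0.$ (iv) $\limsup_{n\to\infty}\sup_{z\in\mathbb{D}}(n+1)^\alpha(1-|z|^2)^\beta\,|\varphi(z)^n g(z)-\psi(z)^n h(z)|=0.$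
   Context: $\mathbb{D}$ is the open unit disk in $\mathbb{C}$, $H(\mathbb{D})$ is the set of analytic functions on $\mathbb{D}$, and $S(\mathbb{D})$ is the set of analytic self-maps of $\mathbb{D}$. For $0<\alpha<\infty$, the $\alpha$-Bloch space $\mathcal{B}^\alpha$ is the set of $f\in H(\mathbb{D})$ with $\|f\|_\alpha=\sup_{z\in\mathbb{D}}(1-|z|^2)^\alpha|f'(z)|<\infty$, a Banach space under the norm $\|f\|_{\mathcal{B}^\alpha}=|f(0)|+\|f\|_\alpha$. For $g\in H(\mathbb{D})$ and $\varphi\in S(\mathbb{D})$, the generalized composition operator is $C^g_\varphi f(z)=\int_0^z f'(\varphi(\xi))g(\xi)\,d\xi$, $z\in\mathbb{D}$. For $\varphi,\psi\in S(\mathbb{D})$ and $g,h\in H(\mathbb{D})$ put $$\rho(z)=\left|\frac{\psi(z)-\varphi(z)}{1-\overline{\psi(z)}\varphi(z)}\right|,\quad D_{\varphi,g}(z)=\frac{(1-|z|^2)^\beta g(z)}{(1-|\varphi(z)|^2)^\alpha},\quad D_{\psi,h}(z)=\frac{(1-|z|^2)^\beta h(z)}{(1-|\psi(z)|^2)^\alpha}.$$ For $a\in\mathbb{D}$, the test functions are (with principal branches of the powers) $$f_a(z)=\int_0^z\frac{(1-|a|^2)^\alpha}{(1-\overline{a}u)^{2\alpha}}\,du,\qquad g_a(z)=\int_0^z\frac{(1-|a|^2)^\alpha}{(1-\overline{a}u)^{2\alpha}}\,\frac{a-u}{1-\overline{a}u}\,du.$$ Suprema are over $z\in\mathbb{D}$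 satisfying the indicated conditions, and a supremum over the empty set is $0$; $r\to1$ means $r\to1^-$, and $|a|\to1$ is taken over $a\in\mathbb{D}$. *)

theory Defs
  imports "HOL-Complex_Analysis.Complex_Analysis"
begin

abbreviation unit_disk :: "complex set" where
  "unit_disk \<equiv> ball 0 1"

definition self_map :: "(complex \<Rightarrow> complex) \<Rightarrow> bool" where
  "self_map \<phi> \<longleftrightarrow> \<phi> holomorphic_on unit_disk \<and> \<phi> \<in> unit_disk \<rightarrow> unit_disk"

text \<open>
  The elements of the Bloch space are functions on the disk.  They are represented by total
  functions that vanish off the disk, so that equality of functions on the disk is HOL equality
  and pointwise subtraction, \<open>(-)\<close> on functions, stays in the space.
\<close>

definition bloch :: "real \<Rightarrow> (complex \<Rightarrow> complex) set" where
  "bloch \<alpha> = {f. f holomorphic_on unit_disk \<and> (\<forall>z. z \<notin> unit_disk \<longrightarrow> f z = 0) \<and>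
                 bdd_above ((\<lambda>z. (1 - (cmod z)\<^sup>2) powr \<alpha> * cmod (deriv f z)) ` unit_disk)}"

definition bloch_seminorm :: "real \<Rightarrow> (complex \<Rightarrow> complex) \<Rightarrow> real" where
  "bloch_seminorm \<alpha> f = (SUP z\<in>unit_disk. (1 - (cmod z)\<^sup>2) powr \<alpha> * cmod (deriv f z))"

definition bloch_norm :: "real \<Rightarrow> (complex \<Rightarrow> complex) \<Rightarrow> real" where
  "bloch_norm \<alpha> f = cmod (f 0) + bloch_seminorm \<alpha> f"

text \<open>The locale \<open>Metric_space\<close> requires symmetry and nonnegativity also off the carrier.\<close>

definition bloch_dist :: "real \<Rightarrow> (complex \<Rightarrow> complex) \<Rightarrow> (complex \<Rightarrow> complex) \<Rightarrow> real" where
  "bloch_dist \<alpha> f g = (if f \<in> bloch \<alpha> \<and> g \<in> bloch \<alpha> then bloch_norm \<alpha> (f - g) else 0)"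

lemma weight_pos: "z \<in> unit_disk \<Longrightarrow> 0 < 1 - (cmod z)\<^sup>2"
  by (simp add: abs_square_less_1)

lemma deriv_diff_disk:
  assumes "f holomorphic_on unit_disk" "g holomorphic_on unit_disk" "z \<in> unit_disk"
  shows "deriv (f - g) z = deriv f z - deriv g z"
  using assms holomorphic_on_imp_differentiable_at[OF _ open_ball]
  unfolding fun_diff_def by (intro deriv_diff) auto

lemma bloch_diff:
  assumes "f \<in> bloch \<alpha>" "g \<in> bloch \<alpha>"
  shows "f - g \<in> bloch \<alpha>"
proof -
  let ?w = "\<lambda>z::complex. (1 - (cmod z)\<^sup>2) powr \<alpha>"
  from assms obtain A B where
    A: "\<And>z. z \<in> unit_disk \<Longrightarrow> ?w z * cmod (deriv f z) \<le> A" and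
    B: "\<And>z. z \<in> unit_disk \<Longrightarrow> ?w z * cmod (deriv g z) \<le> B"
    unfolding bloch_def bdd_above_def by fast
  have hol: "f holomorphic_on unit_disk" "g holomorphic_on unit_disk"
    using assms by (auto simp: bloch_def)
  have "?w z * cmod (deriv (f - g) z) \<le> A + B" if z: "z \<in> unit_disk" for z
  proof -
    have "?w z * cmod (deriv (f - g) z) \<le> ?w z * (cmod (deriv f z) + cmod (deriv g z))"
      unfolding deriv_diff_disk[OF hol z] by (intro mult_left_mono norm_triangle_ineq4) simp
    also have "\<dots> \<le> A + B"
      using A[OF z] B[OF z] by (simp add: distrib_left)
    finally show ?thesis .
  qed
  then have "bdd_above ((\<lambda>z. ?w z * cmod (deriv (f - g) z)) ` unit_disk)"
    by (rule bdd_aboveI2)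
  moreover have "(f - g) holomorphic_on unit_disk"
    using hol unfolding fun_diff_def by (rule holomorphic_on_diff)
  ultimately show ?thesis
    using assms by (auto simp: bloch_def)
qed

lemma bloch_seminorm_upper:
  assumes "f \<in> bloch \<alpha>" "z \<in> unit_disk"
  shows "(1 - (cmod z)\<^sup>2) powr \<alpha> * cmod (deriv f z) \<le> bloch_seminorm \<alpha> f"
  unfolding bloch_seminorm_def using assms by (intro cSUP_upper) (auto simp: bloch_def)

lemma bloch_norm_nonneg:
  assumes "f \<in> bloch \<alpha>"
  shows "0 \<le> bloch_norm \<alpha> f"
proof -
  have "0 \<le> (1 - (cmod (0::complex))\<^sup>2) powr \<alpha> * cmod (deriv f 0)" by simp
  also have "\<dots> \<le> bloch_seminorm \<alpha> f"
    by (rule bloch_seminorm_upper[OF assms]) simp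
  finally show ?thesis by (simp add: bloch_norm_def)
qed

lemma bloch_norm_eq_0:
  assumes f: "f \<in> bloch \<alpha>" and "bloch_norm \<alpha> f = 0"
  shows "f z = 0"
proof -
  have "0 \<le> (1 - (cmod (0::complex))\<^sup>2) powr \<alpha> * cmod (deriv f 0)" by simp
  also have "\<dots> \<le> bloch_seminorm \<alpha> f"
    by (rule bloch_seminorm_upper[OF f]) simp
  finally have s: "bloch_seminorm \<alpha> f = 0" and "cmod (f 0) = 0"
    using assms(2) norm_ge_zero[of "f 0"] unfolding bloch_norm_def by linarith+
  then have f0: "f 0 = 0" by simp
  have hol: "f holomorphic_on unit_disk" using f by (simp add: bloch_def)
  have "(f has_field_derivative 0) (at u)" if u: "u \<in> unit_disk" for u
  proof -
    have "(1 - (cmod u)\<^sup>2) powr \<alpha> * cmod (deriv f u) \<le> 0"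
      using bloch_seminorm_upper[OF f u] s by simp
    moreover have "0 < (1 - (cmod u)\<^sup>2) powr \<alpha>"
      using weight_pos[OF u] by simp
    ultimately have "deriv f u = 0"
      by (simp add: mult_le_0_iff)
    with holomorphic_derivI[OF hol open_ball u] show ?thesis by simp
  qed
  then have "f z = f 0" if "z \<in> unit_disk"
    using that has_field_derivative_zero_constant[of unit_disk f]
    by (metis centre_in_ball convex_ball has_field_derivative_at_within zero_less_one)
  then show ?thesis
    using f f0 by (cases "z \<in> unit_disk") (auto simp: bloch_def)
qed

lemma bloch_norm_diff_triangle:
  assumes "f \<in> bloch \<alpha>" "g \<in> bloch \<alpha>" "h \<in> bloch \<alpha>"
  shows "bloch_norm \<alpha> (f - h) \<le> bloch_norm \<alpha> (f - g) + bloch_norm \<alpha> (g - h)"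
proof -
  have hol: "f holomorphic_on unit_disk" "g holomorphic_on unit_disk" "h holomorphic_on unit_disk"
    using assms by (auto simp: bloch_def)
  have "bloch_seminorm \<alpha> (f - h) \<le> bloch_seminorm \<alpha> (f - g) + bloch_seminorm \<alpha> (g - h)"
    unfolding bloch_seminorm_def[of \<alpha> "f - h"]
  proof (rule cSUP_least)
    fix z :: complex assume z: "z \<in> unit_disk"
    let ?w = "(1 - (cmod z)\<^sup>2) powr \<alpha>"
    have "?w * cmod (deriv (f - h) z) \<le> ?w * (cmod (deriv (f - g) z) + cmod (deriv (g - h) z))"
      using norm_triangle_ineq[of "deriv f z - deriv g z" "deriv g z - deriv h z"]
      by (intro mult_left_mono)
         (simp_all only: deriv_diff_disk[OF hol(1,3) z] deriv_diff_disk[OF hol(1,2) z]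
            deriv_diff_disk[OF hol(2,3) z], simp_all)
    also have "\<dots> \<le> bloch_seminorm \<alpha> (f - g) + bloch_seminorm \<alpha> (g - h)"
      unfolding distrib_left
      by (intro add_mono bloch_seminorm_upper bloch_diff assms z)
    finally show "?w * cmod (deriv (f - h) z) \<le> \<dots>" .
  qed simp
  moreover have "cmod ((f - h) 0) \<le> cmod ((f - g) 0) + cmod ((g - h) 0)"
    using norm_triangle_ineq[of "f 0 - g 0" "g 0 - h 0"] by simp
  ultimately show ?thesis by (simp add: bloch_norm_def)
qed

lemma bloch_norm_minus_commute:
  assumes "f \<in> bloch \<alpha>" "g \<in> bloch \<alpha>"
  shows "bloch_norm \<alpha> (f - g) = bloch_norm \<alpha> (g - f)"
proof -
  have hol: "f holomorphic_on unit_disk" "g holomorphic_on unit_disk"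
    using assms by (auto simp: bloch_def)
  have "bloch_seminorm \<alpha> (f - g) = bloch_seminorm \<alpha> (g - f)"
    unfolding bloch_seminorm_def
    by (intro SUP_cong refl arg_cong2[where f="(*)"])
       (simp only: deriv_diff_disk[OF hol] deriv_diff_disk[OF hol(2,1)] norm_minus_commute)
  then show ?thesis
    by (simp add: bloch_norm_def norm_minus_commute)
qed

lemma bloch_norm_diff_self: "bloch_norm \<alpha> (f - f) = 0"
  by (simp add: fun_diff_def bloch_norm_def bloch_seminorm_def)

lemma Metric_space_bloch: "Metric_space (bloch \<alpha>) (bloch_dist \<alpha>)"
proof
  fix f g h :: "complex \<Rightarrow> complex"
  show "0 \<le> bloch_dist \<alpha> f g"
    by (simp add: bloch_dist_def bloch_norm_nonneg bloch_diff)
  show "bloch_dist \<alpha> f g = bloch_dist \<alpha> g f"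
    by (simp add: bloch_dist_def bloch_norm_minus_commute)
  assume f: "f \<in> bloch \<alpha>" and g: "g \<in> bloch \<alpha>"
  show "bloch_dist \<alpha> f g = 0 \<longleftrightarrow> f = g"
  proof
    assume "bloch_dist \<alpha> f g = 0"
    then have "(f - g) z = 0" for z
      using bloch_norm_eq_0[OF bloch_diff[OF f g]] f g by (simp add: bloch_dist_def)
    then show "f = g" by (simp add: fun_eq_iff)
  qed (simp add: bloch_dist_def bloch_norm_diff_self)
  assume h: "h \<in> bloch \<alpha>"
  show "bloch_dist \<alpha> f h \<le> bloch_dist \<alpha> f g + bloch_dist \<alpha> g h"
    using bloch_norm_diff_triangle[OF f g h] f g h by (simp add: bloch_dist_def)
qed

definition bounded_operator ::
  "real \<Rightarrow> real \<Rightarrow> ((complex \<Rightarrow> complex) \<Rightarrow> complex \<Rightarrow> complex) \<Rightarrow> bool" where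
  "bounded_operator \<alpha> \<beta> T \<longleftrightarrow> T \<in> bloch \<alpha> \<rightarrow> bloch \<beta> \<and>
     (\<exists>C. \<forall>f\<in>bloch \<alpha>. bloch_norm \<beta> (T f) \<le> C * bloch_norm \<alpha> f)"

definition compact_operator ::
  "real \<Rightarrow> real \<Rightarrow> ((complex \<Rightarrow> complex) \<Rightarrow> complex \<Rightarrow> complex) \<Rightarrow> bool" where
  "compact_operator \<alpha> \<beta> T \<longleftrightarrow> T \<in> bloch \<alpha> \<rightarrow> bloch \<beta> \<and>
     (\<forall>B. Metric_space.mbounded (bloch \<alpha>) (bloch_dist \<alpha>) B \<longrightarrow>
        compactin (Metric_space.mtopology (bloch \<beta>) (bloch_dist \<beta>))
          (Metric_space.mtopology (bloch \<beta>) (bloch_dist \<beta>) closure_of (T ` B)))"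

text \<open>
  All integrands below are holomorphic on the disk, so \<open>\<integral>\<^sub>0\<^sup>z\<close> does not depend on the path
  and may be taken along the segment.
\<close>

definition disk_primitive :: "(complex \<Rightarrow> complex) \<Rightarrow> complex \<Rightarrow> complex" where
  "disk_primitive F z = (if z \<in> unit_disk then contour_integral (linepath 0 z) F else 0)"

definition gen_comp ::
  "(complex \<Rightarrow> complex) \<Rightarrow> (complex \<Rightarrow> complex) \<Rightarrow> (complex \<Rightarrow> complex) \<Rightarrow> complex \<Rightarrow> complex" where
  "gen_comp \<phi> g f = disk_primitive (\<lambda>\<xi>. deriv f (\<phi> \<xi>) * g \<xi>)"

definition pseudo_hyp ::
  "(complex \<Rightarrow> complex) \<Rightarrow> (complex \<Rightarrow> complex) \<Rightarrow> complex \<Rightarrow> real" where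
  "pseudo_hyp \<phi> \<psi> z = cmod ((\<psi> z - \<phi> z) / (1 - cnj (\<psi> z) * \<phi> z))"

definition D_quot ::
  "real \<Rightarrow> real \<Rightarrow> (complex \<Rightarrow> complex) \<Rightarrow> (complex \<Rightarrow> complex) \<Rightarrow> complex \<Rightarrow> complex" where
  "D_quot \<alpha> \<beta> \<phi> g z =
     of_real ((1 - (cmod z)\<^sup>2) powr \<beta>) * g z / of_real ((1 - (cmod (\<phi> z))\<^sup>2) powr \<alpha>)"

definition test_f :: "real \<Rightarrow> complex \<Rightarrow> complex \<Rightarrow> complex" where
  "test_f \<alpha> a = disk_primitive
     (\<lambda>u. of_real ((1 - (cmod a)\<^sup>2) powr \<alpha>) / (1 - cnj a * u) powr of_real (2 * \<alpha>))"

definition test_g :: "real \<Rightarrow> complex \<Rightarrow> complex \<Rightarrow> complex" where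
  "test_g \<alpha> a = disk_primitive
     (\<lambda>u. of_real ((1 - (cmod a)\<^sup>2) powr \<alpha>) / (1 - cnj a * u) powr of_real (2 * \<alpha>)
          * ((a - u) / (1 - cnj a * u)))"

text \<open>The filter of \<open>|a| \<rightarrow> 1\<close> with \<open>a\<close> in the disk.\<close>

definition to_circle :: "complex filter" where
  "to_circle = filtercomap cmod (at_left 1)"

end

theory Submission
  imports Defs
begin

text \<open>
  Everything is read off from derivatives: at \<open>z\<close>, the weighted derivative of the image of \<open>f\<close>
  under the difference of the two operators is \<open>D\<^sub>\<phi>(z) F(\<phi> z) - D\<^sub>\<psi>(z) F(\<psi> z)\<close> with
  \<open>F(w) = (1 - |w|\<^sup>2)\<^sup>\<alpha> f'(w)\<close>, and \<open>F\<close> is Lipschitz for the pseudohyperbolic distance with constant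
  proportional to the norm of \<open>f\<close>.  Testing this on \<open>f\<^sub>a\<close> and \<open>g\<^sub>a\<close> at \<open>a = \<phi> z\<close> gives (iii) \<open>\<Longrightarrow>\<close> (ii),
  since \<open>F\<close> has modulus 1, respectively vanishes, at \<open>\<phi> z\<close>.  Conversely (ii) bounds the difference by
  the size of \<open>f'\<close> on a compact disk, and Montel's theorem yields compactness.  A compact
  difference annihilates in the limit every bounded sequence whose derivatives tend to 0 pointwise,
  in particular the test functions and the normalised monomials.  Finally (iv) \<open>\<Longrightarrow>\<close> (iii) by expanding
  the test functions in binomial series and estimating termwise.
\<close>

section \<open>Weighted growth and the pseudohyperbolic distance\<close>

text \<open>The obstacle is that at each z the difference mixes values at the two points
  \<open>\<phi> z\<close> and \<open>\<psi> z\<close>, so contributions may cancel and no single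
  test function reveals \<open>Dg z\<close>. The function f_a determines \<open>Dg z\<close> only up
  to a multiple of \<open>Dh z\<close>; g_a isolates that multiple, but only after a factor
  \<rho>(z). This is why \<rho> appears in the first two limits of (ii), while the third must
  compare the two quotients themselves. Condition (ii) says nothing where both
  \<open>\<phi> z\<close> and \<open>\<psi> z\<close> stay in a compact disk. There the boundedness
  of each operator separately takes over: it makes \<open>Dg\<close> and \<open>Dh\<close> bounded,
  and the smallness comes from f' alone. Similarly (iv) says nothing about small n. In the binomial
  series the finitely many first terms are killed by a positive power of 1 - |a|^2, the others by
  (iv). The operators see only f', and every image vanishes at 0, so additive constants never have
  to be followed.\<close>

lemma powr_sub_one_lipschitz:
  fixes \<alpha> l u :: real
  assumes "0 < l"
  shows "\<exists>C\<ge>0. \<forall>x\<in>{l..u}. \<bar>x powr \<alpha> - 1\<bar> \<le> C * \<bar>x - 1\<bar>"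
proof -
  \<comment> \<open>The interval is widened to contain 1, so that the mean value inequality applies
    between x and 1; it stays away from 0 because l does.\<close>
  define S where "S = {min l 1..max u 1}"
  have pos: "x > 0" if "x \<in> S" for x using that assms by (auto simp: S_def)
  have "continuous_on S (\<lambda>x. \<alpha> * x powr (\<alpha> - 1))"
    using pos by (intro continuous_intros) force+
  then have "bounded ((\<lambda>x. \<alpha> * x powr (\<alpha> - 1)) ` S)"
    by (intro compact_imp_bounded compact_continuous_image) (auto simp: S_def)
  then obtain C where C: "C > 0" "\<And>x. x \<in> S \<Longrightarrow> norm (\<alpha> * x powr (\<alpha> - 1)) \<le> C"
    unfolding bounded_pos by blast
  have "norm (x powr \<alpha> - 1 powr \<alpha>) \<le> C * norm (x - 1)" if "x \<in> {l..u}" for x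
  proof (rule field_differentiable_bound[of S])
    show "((\<lambda>x. x powr \<alpha>) has_field_derivative \<alpha> * x powr (\<alpha> - 1)) (at x within S)"
      if "x \<in> S" for x
      using pos[OF that] by (auto intro!: derivative_eq_intros simp: powr_diff)
  qed (use C that in \<open>auto simp: S_def\<close>)
  then show ?thesis using C(1) by (intro exI[of _ C]) auto
qed

lemma one_minus_norm_le_weight:
  fixes z :: complex
  assumes "cmod z < 1"
  shows "1 - cmod z \<le> 1 - (cmod z)\<^sup>2" "1 - (cmod z)\<^sup>2 \<le> 2 * (1 - cmod z)"
proof -
  have "(cmod z)\<^sup>2 \<le> cmod z"
    using assms by (simp add: power2_eq_square mult_left_le)
  then show "1 - cmod z \<le> 1 - (cmod z)\<^sup>2" by simp
  have "0 \<le> (1 - cmod z)\<^sup>2" by simp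
  then show "1 - (cmod z)\<^sup>2 \<le> 2 * (1 - cmod z)" by (simp add: power2_eq_square algebra_simps)
qed

text \<open>Cauchy's estimate on the circle of radius (1 - |w|)/2 about w: on it the distance to the
  boundary is still at least that radius, which bounds F there by K times its power -\<alpha>. The
  factor 2 to the power \<alpha> + 1 comes from halving the distance.\<close>

lemma weighted_growth_deriv_bound:
  assumes hol: "F holomorphic_on unit_disk" and "0 < \<alpha>"
    and bd: "\<And>w. w \<in> unit_disk \<Longrightarrow> (1 - (cmod w)\<^sup>2) powr \<alpha> * cmod (F w) \<le> K"
    and w: "w \<in> unit_disk"
  shows "cmod (deriv F w) \<le> 2 powr (\<alpha> + 1) * K / (1 - cmod w) powr (\<alpha> + 1)"
proof -
  define \<delta> where "\<delta> = (1 - cmod w) / 2"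
  have \<delta>: "\<delta> > 0" using w by (simp add: \<delta>_def)
  have K: "0 \<le> K" using bd[OF w] by (rule order_trans[rotated]) simp
  have sub: "cball w \<delta> \<subseteq> unit_disk"
  proof
    fix x assume "x \<in> cball w \<delta>"
    then have "cmod (x - w) \<le> \<delta>" by (simp add: dist_norm norm_minus_commute)
    then show "x \<in> unit_disk" using norm_triangle_sub[of x w] \<delta> by (auto simp: \<delta>_def field_simps)
  qed
  have "cmod ((deriv ^^ 1) F w) \<le> fact 1 * (K / \<delta> powr \<alpha>) / \<delta> ^ 1"
  proof (rule Cauchy_inequality)
    show "F holomorphic_on ball w \<delta>" using hol sub by (meson ball_subset_cball holomorphic_on_subset)
    show "continuous_on (cball w \<delta>) F"
      using hol sub by (meson holomorphic_on_imp_continuous_on holomorphic_on_subset)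
    fix x assume x: "cmod (w - x) = \<delta>"
    then have xD: "x \<in> unit_disk" using sub by (auto simp: dist_norm)
    have "cmod x \<le> cmod w + \<delta>" using x norm_triangle_sub[of x w] by (simp add: norm_minus_commute)
    then have "\<delta> \<le> 1 - cmod x" by (simp add: \<delta>_def field_simps)
    also have "\<dots> \<le> 1 - (cmod x)\<^sup>2" using xD by (intro one_minus_norm_le_weight) simp
    finally have "\<delta> powr \<alpha> * cmod (F x) \<le> (1 - (cmod x)\<^sup>2) powr \<alpha> * cmod (F x)"
      using \<delta> \<open>0 < \<alpha>\<close> by (intro mult_right_mono powr_mono2) auto
    also have "\<dots> \<le> K" by (rule bd[OF xD])
    finally show "cmod (F x) \<le> K / \<delta> powr \<alpha>" using \<delta> by (simp add: field_simps)
  qed (rule \<delta>)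
  also have "\<dots> = 2 powr (\<alpha> + 1) * K / (1 - cmod w) powr (\<alpha> + 1)"
    using \<delta> by (simp add: \<delta>_def powr_divide powr_add field_simps)
  finally show ?thesis by simp
qed

text \<open>The pseudohyperbolic distance as a function of two points:
  \<open>pseudo_hyp \<phi> \<psi> z\<close> is \<open>pdist (\<phi> z) (\<psi> z)\<close>. In this
  form it is symmetric and applies to any pair of points, such as a kernel's parameter and its
  argument.\<close>

definition pdist :: "complex \<Rightarrow> complex \<Rightarrow> real" where
  "pdist a b = cmod ((b - a) / (1 - cnj b * a))"

lemma disk_mult_less_1:
  assumes "a \<in> unit_disk" "b \<in> unit_disk"
  shows "cmod (cnj a * b) < 1"
  using assms mult_strict_mono'[of "cmod a" 1 "cmod b" 1] by (simp add: norm_mult)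

lemma one_minus_cnj_mult_nonzero:
  assumes "a \<in> unit_disk" "b \<in> unit_disk"
  shows "1 - cnj a * b \<noteq> 0"
  using disk_mult_less_1[OF assms] by auto

lemma pdist_commute: "pdist a b = pdist b a"
proof -
  have "cmod (1 - cnj b * a) = cmod (cnj (1 - cnj b * a))" by (simp only: complex_mod_cnj)
  also have "\<dots> = cmod (1 - cnj a * b)" by (simp add: mult.commute)
  finally show ?thesis by (simp add: pdist_def norm_divide norm_minus_commute)
qed

lemma pdist_nonneg [simp]: "0 \<le> pdist a b"
  by (simp add: pdist_def)

lemma norm_one_minus_cnj_sq:
  "(cmod (1 - cnj a * b))\<^sup>2 - (cmod (b - a))\<^sup>2 = (1 - (cmod a)\<^sup>2) * (1 - (cmod b)\<^sup>2)"
  unfolding cmod_power2 by (simp add: algebra_simps power2_eq_square)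

text \<open>To the power \<alpha>, the right-hand side is the weighted modulus of the derivative of
  f_a at b, which therefore depends on the pseudohyperbolic distance only.\<close>

lemma one_minus_pdist_sq:
  assumes "a \<in> unit_disk" "b \<in> unit_disk"
  shows "1 - (pdist a b)\<^sup>2 = (1 - (cmod a)\<^sup>2) * (1 - (cmod b)\<^sup>2) / (cmod (1 - cnj a * b))\<^sup>2"
proof -
  have "pdist a b = cmod (b - a) / cmod (1 - cnj a * b)"
    by (subst pdist_commute) (simp add: pdist_def norm_divide norm_minus_commute)
  then have "(pdist a b)\<^sup>2 = (cmod (b - a))\<^sup>2 / (cmod (1 - cnj a * b))\<^sup>2"
    by (simp add: power_divide)
  then show ?thesis
    using one_minus_cnj_mult_nonzero[OF assms]
    unfolding norm_one_minus_cnj_sq[of a b, symmetric] by (simp add: diff_divide_distrib)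
qed

lemma pdist_le_1:
  assumes "a \<in> unit_disk" "b \<in> unit_disk"
  shows "pdist a b \<le> 1"
proof -
  have "0 \<le> 1 - (pdist a b)\<^sup>2"
    unfolding one_minus_pdist_sq[OF assms] using weight_pos assms by (simp add: less_imp_le)
  then show ?thesis by (simp add: abs_square_le_1)
qed

text \<open>Since |1 - cnj a * b| is at most 2(1 - |a|) + |b - a|, multiplying by
  \<open>pdist a b\<close> gives a bound in which |b - a| reappears with a factor at most 1/10.
  Absorbing it on the left gives the constant 20/9, rounded up to 3.\<close>

lemma pdist_small_euclidean:
  assumes "a \<in> unit_disk" "b \<in> unit_disk" "pdist a b \<le> 1 / 10"
  shows "cmod (b - a) \<le> 3 * pdist a b * (1 - cmod a)"
proof -
  let ?p = "pdist a b" and ?d = "1 - cmod a"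
  have "cmod (b - a) = ?p * cmod (1 - cnj a * b)"
    using one_minus_cnj_mult_nonzero[OF assms(1,2)]
    by (subst pdist_commute) (simp add: pdist_def norm_divide norm_minus_commute)
  also have "\<dots> \<le> ?p * (2 * ?d + cmod (b - a))"
  proof (rule mult_left_mono)
    have "1 - cnj a * b = of_real (1 - (cmod a)\<^sup>2) - cnj a * (b - a)"
      by (simp only: of_real_diff complex_norm_square) (simp add: algebra_simps)
    also have "cmod \<dots> \<le> cmod (of_real (1 - (cmod a)\<^sup>2)) + cmod (cnj a * (b - a))"
      by (rule norm_triangle_ineq4)
    also have "\<dots> \<le> 2 * ?d + cmod (b - a)"
    proof (rule add_mono)
      show "cmod (of_real (1 - (cmod a)\<^sup>2)) \<le> 2 * ?d"
        unfolding norm_of_real using one_minus_norm_le_weight[of a] assms(1) by simp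
      show "cmod (cnj a * (b - a)) \<le> cmod (b - a)"
        using assms(1) by (simp add: norm_mult mult_left_le_one_le)
    qed
    finally show "cmod (1 - cnj a * b) \<le> 2 * ?d + cmod (b - a)" .
  qed simp
  finally have "(1 - ?p) * cmod (b - a) \<le> 2 * ?p * ?d" by (simp add: algebra_simps)
  moreover have "9/10 * cmod (b - a) \<le> (1 - ?p) * cmod (b - a)"
    using assms(3) by (intro mult_right_mono) auto
  ultimately have "cmod (b - a) \<le> 20/9 * (?p * ?d)" by simp
  also have "\<dots> \<le> 3 * (?p * ?d)" using assms(1) by (intro mult_right_mono) auto
  finally show ?thesis by simp
qed

text \<open>
  The weighted function \<open>(1 - |w|\<^sup>2)\<^sup>\<alpha> F w\<close> carries no phase, so this estimate does not follow
  from conformal invariance alone; near the diagonal it is obtained from Cauchy's estimate.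
\<close>

lemma weighted_lipschitz:
  assumes "0 < \<alpha>"
  obtains C where "0 \<le> C" and
    "\<And>F K a b. \<lbrakk>F holomorphic_on unit_disk;
        \<And>w. w \<in> unit_disk \<Longrightarrow> (1 - (cmod w)\<^sup>2) powr \<alpha> * cmod (F w) \<le> K;
        a \<in> unit_disk; b \<in> unit_disk\<rbrakk> \<Longrightarrow>
      cmod (of_real ((1 - (cmod a)\<^sup>2) powr \<alpha>) * F a - of_real ((1 - (cmod b)\<^sup>2) powr \<alpha>) * F b)
        \<le> C * K * pdist a b"
proof -
  \<comment> \<open>The range 3/8 to 3 is that of the quotient of the weights at a and b for nearby
    points: with \<delta> = 1 - |a|, the weight at a lies between \<delta> and 2\<delta>, the one at
    b between 2\<delta>/3 and 8\<delta>/3.\<close>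
  obtain L where L: "0 \<le> L"
    "\<And>x. x \<in> {3/8..3} \<Longrightarrow> \<bar>x powr \<alpha> - 1\<bar> \<le> L * \<bar>x - 1\<bar>"
    using powr_sub_one_lipschitz[of "3/8" 3 \<alpha>] by auto
  \<comment> \<open>The factors come from the weight at a, at most (2\<delta>) to the power
    \<alpha>; from the derivative bound where the distance to the circle is at least 2\<delta>/3;
    and from the Euclidean estimate |b - a| \<le> 3 * pdist * \<delta>.\<close>
  define C1 where "C1 = 2 powr \<alpha> * (2 powr (\<alpha> + 1) * (3/2) powr (\<alpha> + 1)) * 3"
  have C1: "0 \<le> C1" by (simp add: C1_def)
  \<comment> \<open>20 serves the distant points, where the trivial bound 2K is at most 20 * K *
    pdist; \<open>C1\<close> pays for the change of F and 9 * L for the change of the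
    weight.\<close>
  define C where "C = 20 + C1 + 9 * L"
  show ?thesis
  proof (rule that)
    show "0 \<le> C" using L(1) C1 by (simp add: C_def)
    fix F K a b
    assume hol: "F holomorphic_on unit_disk"
      and bd: "\<And>w. w \<in> unit_disk \<Longrightarrow> (1 - (cmod w)\<^sup>2) powr \<alpha> * cmod (F w) \<le> K"
      and a: "a \<in> unit_disk" and b: "b \<in> unit_disk"
    let ?w = "\<lambda>z::complex. (1 - (cmod z)\<^sup>2) powr \<alpha>" and ?p = "pdist a b"
    have K: "0 \<le> K" using bd[OF a] by (rule order_trans[rotated]) simp
    show "cmod (of_real (?w a) * F a - of_real (?w b) * F b) \<le> C * K * ?p"
    proof (cases "?p \<le> 1/10")
      case False
      have "cmod (of_real (?w a) * F a - of_real (?w b) * F b)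
          \<le> cmod (of_real (?w a) * F a) + cmod (of_real (?w b) * F b)"
        by (rule norm_triangle_ineq4)
      also have "\<dots> \<le> K + K" using bd[OF a] bd[OF b] by (simp add: norm_mult)
      also have "\<dots> = 20 * K * (1/10)" by simp
      also have "\<dots> \<le> C * K * ?p"
        using False K L(1) C1 by (intro mult_mono mult_right_mono) (auto simp: C_def)
      finally show ?thesis .
    next
      case True
      define \<delta> where "\<delta> = 1 - cmod a"
      have \<delta>: "0 < \<delta>" using a by (simp add: \<delta>_def)
      have ab: "cmod (b - a) \<le> 3 * ?p * \<delta>"
        using pdist_small_euclidean[OF a b True] by (simp add: \<delta>_def)
      also have "3 * ?p * \<delta> \<le> 3 * (1/10) * \<delta>" using True \<delta> by (intro mult_right_mono) auto
      finally have ab3: "cmod (b - a) \<le> \<delta> / 3" using \<delta> by simp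
      have lo: "2 * \<delta> / 3 \<le> 1 - cmod x" if "x \<in> cball a (\<delta>/3)" for x
        using that norm_triangle_sub[of x a] by (simp add: dist_norm norm_minus_commute \<delta>_def)
      have sub: "cball a (\<delta>/3) \<subseteq> unit_disk" using lo \<delta> by fastforce
      have bin: "b \<in> cball a (\<delta>/3)" using ab3 by (simp add: dist_norm norm_minus_commute)
      have wa: "\<delta> \<le> 1 - (cmod a)\<^sup>2" "1 - (cmod a)\<^sup>2 \<le> 2 * \<delta>"
        using one_minus_norm_le_weight[of a] a by (auto simp: \<delta>_def)
      have wb: "2 * \<delta> / 3 \<le> 1 - (cmod b)\<^sup>2" "1 - (cmod b)\<^sup>2 \<le> 8 * \<delta> / 3"
      proof -
        show "2 * \<delta> / 3 \<le> 1 - (cmod b)\<^sup>2"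
          using one_minus_norm_le_weight[of b] b lo[OF bin] by simp
        have "1 - cmod b \<le> 4 * \<delta> / 3"
          using ab3 norm_triangle_sub[of a b] by (simp add: \<delta>_def norm_minus_commute)
        then show "1 - (cmod b)\<^sup>2 \<le> 8 * \<delta> / 3"
          using one_minus_norm_le_weight[of b] b by simp
      qed
      have "cmod (F b - F a) \<le> 2 powr (\<alpha> + 1) * K / (2 * \<delta> / 3) powr (\<alpha> + 1) * cmod (b - a)"
      proof (rule field_differentiable_bound[of "cball a (\<delta>/3)"])
        fix x assume x: "x \<in> cball a (\<delta>/3)"
        then have xD: "x \<in> unit_disk" using sub by auto
        show "(F has_field_derivative deriv F x) (at x within cball a (\<delta>/3))"
          using holomorphic_derivI[OF hol open_ball xD] by (rule has_field_derivative_at_within)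
        have "cmod (deriv F x) \<le> 2 powr (\<alpha> + 1) * K / (1 - cmod x) powr (\<alpha> + 1)"
          by (rule weighted_growth_deriv_bound[OF hol assms bd xD])
        also have "\<dots> \<le> 2 powr (\<alpha> + 1) * K / (2 * \<delta> / 3) powr (\<alpha> + 1)"
          using lo[OF x] \<delta> K assms by (intro divide_left_mono powr_mono2 mult_pos_pos) auto
        finally show "cmod (deriv F x) \<le> 2 powr (\<alpha> + 1) * K / (2 * \<delta> / 3) powr (\<alpha> + 1)" .
      qed (use bin \<delta> in auto)
      also have "\<dots> \<le> 2 powr (\<alpha> + 1) * K / (2 * \<delta> / 3) powr (\<alpha> + 1) * (3 * ?p * \<delta>)"
        using ab K by (intro mult_left_mono) auto
      finally have "?w a * cmod (F b - F a)
          \<le> (2 * \<delta>) powr \<alpha> * (2 powr (\<alpha> + 1) * K / (2 * \<delta> / 3) powr (\<alpha> + 1) * (3 * ?p * \<delta>))"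
        using wa \<delta> assms by (intro mult_mono powr_mono2) auto
      also have "\<dots> = C1 * K * ?p"
        using \<delta> by (simp add: C1_def powr_mult powr_divide powr_add field_simps)
      finally have 1: "cmod (of_real (?w a) * (F a - F b)) \<le> C1 * K * ?p"
        by (simp add: norm_mult norm_minus_commute)
      \<comment> \<open>The change of the weight is measured relative to the weight at b, so that
        what multiplies F b is the weight for which K is a bound.\<close>
      define x where "x = (1 - (cmod a)\<^sup>2) / (1 - (cmod b)\<^sup>2)"
      have posb: "0 < 1 - (cmod b)\<^sup>2" using weight_pos[OF b] .
      have "3/8 * (1 - (cmod b)\<^sup>2) \<le> 1 - (cmod a)\<^sup>2"
        using mult_left_mono[OF wb(2), of "3/8"] wa(1) by simp
      moreover have "1 - (cmod a)\<^sup>2 \<le> 3 * (1 - (cmod b)\<^sup>2)"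
        using order_trans[OF wa(2), of "3 * (1 - (cmod b)\<^sup>2)"] mult_left_mono[OF wb(1), of 3]
        by simp
      ultimately have xin: "x \<in> {3/8..3}" using posb by (simp add: x_def field_simps)
      have "\<bar>x - 1\<bar> = \<bar>(cmod b)\<^sup>2 - (cmod a)\<^sup>2\<bar> / (1 - (cmod b)\<^sup>2)"
        using posb by (simp add: x_def field_simps)
      also have "\<dots> \<le> (2 * cmod (b - a)) / (2 * \<delta> / 3)"
      proof (rule frac_le)
        have "\<bar>(cmod b)\<^sup>2 - (cmod a)\<^sup>2\<bar> = \<bar>cmod b - cmod a\<bar> * (cmod b + cmod a)"
          by (simp add: power2_eq_square square_diff_square_factored abs_mult)
        also have "\<dots> \<le> cmod (b - a) * 2"
          using a b by (intro mult_mono norm_triangle_ineq3) auto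
        finally show "\<bar>(cmod b)\<^sup>2 - (cmod a)\<^sup>2\<bar> \<le> 2 * cmod (b - a)" by simp
      qed (use wb \<delta> in auto)
      also have "\<dots> \<le> (2 * (3 * ?p * \<delta>)) / (2 * \<delta> / 3)"
        using ab \<delta> by (intro divide_right_mono mult_left_mono) auto
      also have "\<dots> = 9 * ?p" using \<delta> by (simp add: field_simps)
      finally have x1: "\<bar>x - 1\<bar> \<le> 9 * ?p" .
      have "?w a - ?w b = ?w b * (x powr \<alpha> - 1)"
        using posb wa \<delta> by (simp add: x_def powr_divide field_simps)
      then have "cmod (of_real (?w a - ?w b) * F b) = \<bar>x powr \<alpha> - 1\<bar> * (?w b * cmod (F b))"
        by (simp only: norm_mult norm_of_real abs_mult) simp
      also have "\<dots> \<le> (L * (9 * ?p)) * K"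
      proof (rule mult_mono)
        show "\<bar>x powr \<alpha> - 1\<bar> \<le> L * (9 * ?p)"
          using L(2)[OF xin] mult_left_mono[OF x1 L(1)] by linarith
      qed (use bd[OF b] L(1) in auto)
      finally have 2: "cmod (of_real (?w a - ?w b) * F b) \<le> 9 * L * K * ?p" by (simp add: mult_ac)
      have "of_real (?w a) * F a - of_real (?w b) * F b
          = of_real (?w a) * (F a - F b) + of_real (?w a - ?w b) * F b"
        by (simp add: algebra_simps)
      also have "cmod \<dots> \<le> C1 * K * ?p + 9 * L * K * ?p"
        by (intro norm_triangle_le add_mono 1 2)
      also have "\<dots> \<le> C * K * ?p" using K by (simp add: C_def algebra_simps)
      finally show ?thesis .
    qed
  qed
qed

section \<open>Primitives, limits and binomial series\<close>

text \<open>On the convex disk F has a primitive G, and the integral along the segment is G z - G 0;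
  differentiability is inherited from G.\<close>

lemma disk_primitive_has_field_derivative:
  assumes hol: "F holomorphic_on unit_disk" and z: "z \<in> unit_disk"
  shows "(disk_primitive F has_field_derivative F z) (at z)"
proof -
  obtain G where G: "\<And>x. x \<in> unit_disk \<Longrightarrow> (G has_field_derivative F x) (at x within unit_disk)"
    using holomorphic_convex_primitive'[OF convex_ball open_ball hol] by blast
  have eq: "G x - G 0 = disk_primitive F x" if x: "x \<in> unit_disk" for x
  proof -
    have "(F has_contour_integral (G (pathfinish (linepath 0 x)) - G (pathstart (linepath 0 x))))
        (linepath 0 x)"
    proof (rule contour_integral_primitive[OF G])
      show "path_image (linepath 0 x) \<subseteq> unit_disk"
        using x by (simp add: closed_segment_subset del: mem_ball_0)
    qed auto
    then show ?thesis using x by (simp add: disk_primitive_def contour_integral_unique)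
  qed
  have "((\<lambda>x. G x - G 0) has_field_derivative F z) (at z)"
    using G[OF z] z by (auto simp: at_within_open[OF z open_ball] intro!: derivative_eq_intros)
  then show ?thesis
    by (rule has_field_derivative_transform_within_open[OF _ open_ball z eq])
qed

lemma disk_primitive_holomorphic:
  assumes "F holomorphic_on unit_disk"
  shows "disk_primitive F holomorphic_on unit_disk"
  using disk_primitive_has_field_derivative[OF assms]
  by (meson holomorphic_onI field_differentiable_def field_differentiable_at_within)

lemma deriv_disk_primitive:
  assumes "F holomorphic_on unit_disk" "z \<in> unit_disk"
  shows "deriv (disk_primitive F) z = F z"
  by (rule DERIV_imp_deriv[OF disk_primitive_has_field_derivative[OF assms]])

lemma disk_primitive_0 [simp]: "disk_primitive F 0 = 0"
  by (simp add: disk_primitive_def)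

lemma disk_primitive_outside: "z \<notin> unit_disk \<Longrightarrow> disk_primitive F z = 0"
  by (simp add: disk_primitive_def)

lemma bloch_norm_leI:
  assumes "f 0 = 0"
    and "\<And>z. z \<in> unit_disk \<Longrightarrow> (1 - (cmod z)\<^sup>2) powr \<alpha> * cmod (deriv f z) \<le> K"
  shows "bloch_norm \<alpha> f \<le> K"
  unfolding bloch_norm_def bloch_seminorm_def using assms by (auto intro!: cSUP_least)

lemma bloch_norm_cong:
  assumes "f 0 = g 0" "\<And>z. z \<in> unit_disk \<Longrightarrow> deriv f z = deriv g z"
  shows "bloch_norm \<alpha> f = bloch_norm \<alpha> g"
  unfolding bloch_norm_def bloch_seminorm_def using assms by (auto intro!: SUP_cong)

lemma weighted_deriv_le_bloch_norm:
  assumes "f \<in> bloch \<alpha>" "z \<in> unit_disk"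
  shows "(1 - (cmod z)\<^sup>2) powr \<alpha> * cmod (deriv f z) \<le> bloch_norm \<alpha> f"
  using bloch_seminorm_upper[OF assms] by (simp add: bloch_norm_def add_increasing)

lemma norm_at_0_le_bloch_norm:
  assumes "f \<in> bloch \<alpha>"
  shows "cmod (f 0) \<le> bloch_norm \<alpha> f"
proof -
  have "0 \<le> (1 - (cmod (0::complex))\<^sup>2) powr \<alpha> * cmod (deriv f 0)" by simp
  also have "\<dots> \<le> bloch_seminorm \<alpha> f" by (rule bloch_seminorm_upper[OF assms]) simp
  finally show ?thesis by (simp add: bloch_norm_def)
qed

lemma deriv_holomorphic_of_bloch: "f \<in> bloch \<alpha> \<Longrightarrow> deriv f holomorphic_on unit_disk"
  by (auto simp: bloch_def intro: holomorphic_deriv)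

text \<open>The primitive vanishes at 0, so its norm reduces to the weighted supremum of F.\<close>

lemma disk_primitive_bloch:
  assumes hol: "F holomorphic_on unit_disk"
    and bd: "\<And>z. z \<in> unit_disk \<Longrightarrow> (1 - (cmod z)\<^sup>2) powr \<alpha> * cmod (F z) \<le> K"
  shows "disk_primitive F \<in> bloch \<alpha>" "bloch_norm \<alpha> (disk_primitive F) \<le> K"
proof -
  have *: "(1 - (cmod z)\<^sup>2) powr \<alpha> * cmod (deriv (disk_primitive F) z) \<le> K" if "z \<in> unit_disk" for z
    using bd[OF that] by (simp only: deriv_disk_primitive[OF hol that])
  then show "disk_primitive F \<in> bloch \<alpha>"
    unfolding bloch_def
    by (auto simp: disk_primitive_outside intro!: disk_primitive_holomorphic hol bdd_aboveI2)
  show "bloch_norm \<alpha> (disk_primitive F) \<le> K"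
    by (rule bloch_norm_leI) (use * in auto)
qed

lemma zero_in_bloch: "(\<lambda>_. 0) \<in> bloch \<alpha>"
  by (auto simp: bloch_def)

lemma self_mapD:
  assumes "self_map \<phi>"
  shows "\<phi> holomorphic_on unit_disk" "z \<in> unit_disk \<Longrightarrow> \<phi> z \<in> unit_disk"
  using assms unfolding self_map_def by blast+

lemma gen_comp_integrand_holomorphic:
  assumes "self_map \<phi>" "g holomorphic_on unit_disk" "f holomorphic_on unit_disk"
  shows "(\<lambda>\<xi>. deriv f (\<phi> \<xi>) * g \<xi>) holomorphic_on unit_disk"
proof -
  have "(deriv f \<circ> \<phi>) holomorphic_on unit_disk"
  proof (rule holomorphic_on_compose_gen[of _ _ _ unit_disk])
    show "deriv f holomorphic_on unit_disk" by (rule holomorphic_deriv[OF assms(3) open_ball])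
  qed (use self_mapD[OF assms(1)] in blast)+
  then show ?thesis using assms(2) by (auto simp: o_def intro!: holomorphic_on_mult)
qed

lemma deriv_gen_comp:
  assumes "self_map \<phi>" "g holomorphic_on unit_disk" "f holomorphic_on unit_disk" "z \<in> unit_disk"
  shows "deriv (gen_comp \<phi> g f) z = deriv f (\<phi> z) * g z"
  unfolding gen_comp_def
  by (rule deriv_disk_primitive[OF gen_comp_integrand_holomorphic[OF assms(1-3)] assms(4)])

lemma gen_comp_0 [simp]: "gen_comp \<phi> g f 0 = 0"
  by (simp add: gen_comp_def)

section \<open>Limits at the circle and at infinity in epsilon form\<close>

lemma eventually_to_circle:
  "eventually P to_circle \<longleftrightarrow> (\<exists>r<1. \<forall>a. r < cmod a \<and> cmod a < 1 \<longrightarrow> P a)"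
proof
  assume "eventually P to_circle"
  then obtain Q where "eventually Q (at_left 1)" "\<And>a. Q (cmod a) \<Longrightarrow> P a"
    unfolding to_circle_def eventually_filtercomap by blast
  then show "\<exists>r<1. \<forall>a. r < cmod a \<and> cmod a < 1 \<longrightarrow> P a"
    unfolding eventually_at_left_field by blast
next
  assume "\<exists>r<1. \<forall>a. r < cmod a \<and> cmod a < 1 \<longrightarrow> P a"
  then obtain r where r: "r < 1" "\<And>a. r < cmod a \<Longrightarrow> cmod a < 1 \<Longrightarrow> P a" by blast
  have "eventually (\<lambda>x. r < x \<and> x < 1) (at_left 1)"
    unfolding eventually_at_left_field using r(1) by blast
  then show "eventually P to_circle"
    unfolding to_circle_def eventually_filtercomap using r(2) by blast
qed

lemma to_circle_neq_bot: "to_circle \<noteq> bot"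
proof
  assume "to_circle = bot"
  then obtain r where r: "r < 1" "\<And>a. r < cmod a \<Longrightarrow> cmod a < 1 \<Longrightarrow> False"
    using eventually_to_circle[of "\<lambda>_. False"] by auto
  \<comment> \<open>The midpoint of r and 1, pushed up to 1/2 because r may be negative while x must
    be the modulus of a point.\<close>
  define x where "x = max ((r + 1) / 2) (1 / 2)"
  have "r < x" "0 < x" "x < 1" using r(1) by (auto simp: x_def max_def)
  then show False using r(2)[of "of_real x"] by simp
qed

lemma Limsup_ennreal_eq_0_iff:
  assumes "F \<noteq> bot" and nonneg: "\<forall>\<^sub>F x in F. 0 \<le> f x"
  shows "Limsup F (\<lambda>x. ennreal (f x)) = 0 \<longleftrightarrow> (\<forall>\<epsilon>>0. \<forall>\<^sub>F x in F. f x \<le> \<epsilon>)"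
proof
  assume "Limsup F (\<lambda>x. ennreal (f x)) = 0"
  then have lim: "((\<lambda>x. ennreal (f x)) \<longlongrightarrow> 0) F" by (rule tendsto_0_if_Limsup_eq_0_ennreal)
  show "\<forall>\<epsilon>>0. \<forall>\<^sub>F x in F. f x \<le> \<epsilon>"
  proof (intro allI impI)
    fix \<epsilon> :: real assume \<epsilon>: "\<epsilon> > 0"
    then have "\<forall>\<^sub>F x in F. ennreal (f x) < ennreal \<epsilon>"
      using lim by (intro order_tendstoD(2)) auto
    then show "\<forall>\<^sub>F x in F. f x \<le> \<epsilon>"
      by eventually_elim (use \<epsilon> in \<open>meson ennreal_leI leD linorder_le_cases\<close>)
  qed
next
  assume small: "\<forall>\<epsilon>>0. \<forall>\<^sub>F x in F. f x \<le> \<epsilon>"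
  have "Limsup F (\<lambda>x. ennreal (f x)) \<le> 0 + ennreal \<epsilon>" if "\<epsilon> > 0" for \<epsilon>
  proof -
    have "\<forall>\<^sub>F x in F. ennreal (f x) \<le> ennreal \<epsilon>"
      using small[rule_format, OF that] by eventually_elim (rule ennreal_leI)
    then show ?thesis by (simp add: Limsup_bounded)
  qed
  then have "Limsup F (\<lambda>x. ennreal (f x)) \<le> 0" by (rule ennreal_le_epsilon) auto
  then show "Limsup F (\<lambda>x. ennreal (f x)) = 0" by simp
qed

lemma limsup_SUP_ennreal_eq_0_iff:
  assumes "A \<noteq> {}" "\<And>n z. z \<in> A \<Longrightarrow> 0 \<le> X n z"
  shows "limsup (\<lambda>n. SUP z\<in>A. ennreal (X n z)) = 0 \<longleftrightarrow>
    (\<forall>\<epsilon>>0. \<exists>N. \<forall>n\<ge>N. \<forall>z\<in>A. X n z \<le> \<epsilon>)"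
proof
  assume "limsup (\<lambda>n. SUP z\<in>A. ennreal (X n z)) = 0"
  then have lim: "(\<lambda>n. SUP z\<in>A. ennreal (X n z)) \<longlonglongrightarrow> 0" by (rule tendsto_0_if_Limsup_eq_0_ennreal)
  show "\<forall>\<epsilon>>0. \<exists>N. \<forall>n\<ge>N. \<forall>z\<in>A. X n z \<le> \<epsilon>"
  proof (intro allI impI)
    fix \<epsilon> :: real assume \<epsilon>: "\<epsilon> > 0"
    then have "\<forall>\<^sub>F n in sequentially. (SUP z\<in>A. ennreal (X n z)) < ennreal \<epsilon>"
      using lim by (intro order_tendstoD(2)) auto
    then have "\<forall>\<^sub>F n in sequentially. \<forall>z\<in>A. X n z \<le> \<epsilon>"
    proof eventually_elim
      case (elim n)
      then have "ennreal (X n z) \<le> ennreal \<epsilon>" if "z \<in> A" for z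
        using that by (meson SUP_upper le_less_trans less_imp_le)
      then show ?case using \<epsilon> by (auto simp: ennreal_le_iff)
    qed
    then show "\<exists>N. \<forall>n\<ge>N. \<forall>z\<in>A. X n z \<le> \<epsilon>" by (simp add: eventually_sequentially)
  qed
next
  assume small: "\<forall>\<epsilon>>0. \<exists>N. \<forall>n\<ge>N. \<forall>z\<in>A. X n z \<le> \<epsilon>"
  have "limsup (\<lambda>n. SUP z\<in>A. ennreal (X n z)) \<le> 0 + ennreal \<epsilon>" if "\<epsilon> > 0" for \<epsilon>
  proof -
    have "\<forall>\<^sub>F n in sequentially. \<forall>z\<in>A. X n z \<le> \<epsilon>"
      using small that by (auto simp: eventually_sequentially)
    then have "\<forall>\<^sub>F n in sequentially. (SUP z\<in>A. ennreal (X n z)) \<le> ennreal \<epsilon>"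
      by eventually_elim (auto intro!: SUP_least ennreal_leI)
    then show ?thesis by (simp add: Limsup_bounded)
  qed
  then have "limsup (\<lambda>n. SUP z\<in>A. ennreal (X n z)) \<le> 0" by (rule ennreal_le_epsilon) auto
  then show "limsup (\<lambda>n. SUP z\<in>A. ennreal (X n z)) = 0" by simp
qed

text \<open>In \<open>ennreal\<close> an empty supremum is 0 and an unbounded one is infinite, so no
  side conditions on S or X arise. As S shrinks, one good radius is good for all larger
  ones.\<close>

lemma tendsto_SUP_at_left_1_iff:
  fixes S :: "real \<Rightarrow> 'a set" and X :: "'a \<Rightarrow> real"
  assumes mono: "\<And>r s. r \<le> s \<Longrightarrow> S s \<subseteq> S r"
  shows "((\<lambda>r. SUP z\<in>S r. ennreal (X z)) \<longlongrightarrow> 0) (at_left 1) \<longleftrightarrow>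
    (\<forall>\<epsilon>>0. \<exists>r<1. \<forall>z\<in>S r. X z \<le> \<epsilon>)"
proof
  assume lim: "((\<lambda>r. SUP z\<in>S r. ennreal (X z)) \<longlongrightarrow> 0) (at_left 1)"
  show "\<forall>\<epsilon>>0. \<exists>r<1. \<forall>z\<in>S r. X z \<le> \<epsilon>"
  proof (intro allI impI)
    fix \<epsilon> :: real assume \<epsilon>: "\<epsilon> > 0"
    then have "\<forall>\<^sub>F r in at_left 1. (SUP z\<in>S r. ennreal (X z)) < ennreal \<epsilon>"
      using lim by (intro order_tendstoD(2)) auto
    then obtain b where b: "b < 1" "\<And>r. b < r \<Longrightarrow> r < 1 \<Longrightarrow> (SUP z\<in>S r. ennreal (X z)) < ennreal \<epsilon>"
      unfolding eventually_at_left_field by blast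
    obtain r where r: "b < r" "r < 1" using dense b(1) by blast
    have "ennreal (X z) \<le> ennreal \<epsilon>" if "z \<in> S r" for z
      using that b(2)[OF r] by (meson SUP_upper le_less_trans less_imp_le)
    then show "\<exists>r<1. \<forall>z\<in>S r. X z \<le> \<epsilon>"
      using r \<epsilon> by (auto simp: ennreal_le_iff)
  qed
next
  assume small: "\<forall>\<epsilon>>0. \<exists>r<1. \<forall>z\<in>S r. X z \<le> \<epsilon>"
  have "Limsup (at_left 1) (\<lambda>r. SUP z\<in>S r. ennreal (X z)) \<le> 0 + ennreal \<epsilon>" if \<epsilon>: "\<epsilon> > 0" for \<epsilon>
  proof -
    obtain b where b: "b < 1" "\<And>z. z \<in> S b \<Longrightarrow> X z \<le> \<epsilon>"
      using small \<epsilon> by blast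
    have "\<forall>\<^sub>F r in at_left 1. (SUP z\<in>S r. ennreal (X z)) \<le> ennreal \<epsilon>"
      unfolding eventually_at_left_field
    proof (intro exI conjI allI impI)
      fix r assume "b < r"
      then have "S r \<subseteq> S b" using mono by simp
      then show "(SUP z\<in>S r. ennreal (X z)) \<le> ennreal \<epsilon>"
        using b(2) by (auto intro!: SUP_least ennreal_leI)
    qed (rule b(1))
    then show ?thesis by (simp add: Limsup_bounded)
  qed
  then have "Limsup (at_left 1) (\<lambda>r. SUP z\<in>S r. ennreal (X z)) \<le> 0"
    by (rule ennreal_le_epsilon) auto
  then show "((\<lambda>r. SUP z\<in>S r. ennreal (X z)) \<longlongrightarrow> 0) (at_left 1)"
    by (intro tendsto_0_if_Limsup_eq_0_ennreal) simp
qed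

section \<open>Binomial series with negative exponent and weighted monomials\<close>

lemma pochhammer_shift_bound:
  fixes s \<alpha> :: real
  assumes "0 < s" "0 < \<alpha>"
  obtains C where "0 \<le> C"
    "\<And>k. pochhammer (s + \<alpha>) k \<le> C * (real k + 1) powr \<alpha> * pochhammer s k"
proof -
  \<comment> \<open>Euler's product for Gamma contains a Pochhammer symbol in its denominator, so
    the quotient of two such products is the wanted ratio divided by n to the power \<alpha>; its
    convergence makes it bounded.\<close>
  have "(\<lambda>n. Gamma_series s n / Gamma_series (s + \<alpha>) n) \<longlonglongrightarrow> Gamma s / Gamma (s + \<alpha>)"
    using assms by (intro tendsto_divide Gamma_series_LIMSEQ) (simp add: less_imp_neq[symmetric])
  then have "Bseq (\<lambda>n. Gamma_series s n / Gamma_series (s + \<alpha>) n)"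
    by (intro convergent_imp_Bseq convergentI)
  then obtain B where B: "B > 0" "\<And>n. norm (Gamma_series s n / Gamma_series (s + \<alpha>) n) \<le> B"
    unfolding Bseq_def by auto
  have pos: "0 < pochhammer s k" "0 < pochhammer (s + \<alpha>) k" for k
    using assms by (auto intro!: pochhammer_pos)
  show ?thesis
  \<comment> \<open>The n-th \<open>Gamma_series\<close> reaches the Pochhammer symbol of index n +
    1, so k = 0 is left over; there both symbols are 1 and the constant must be at least 1.\<close>
  proof (rule that[of "max B 1"])
    fix k
    show "pochhammer (s + \<alpha>) k \<le> max B 1 * (real k + 1) powr \<alpha> * pochhammer s k"
    proof (cases k)
      case (Suc n)
      \<comment> \<open>This is n to the power \<alpha>, except that at n = 0 the convention ln 0 =
        0 makes it 1.\<close>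
      define e where "e = exp (\<alpha> * ln (real n))"
      have e: "0 < e" by (simp add: e_def)
      have "e \<le> (real k + 1) powr \<alpha>"
        unfolding e_def Suc powr_def using assms(2)
        by (cases "n = 0") (auto intro!: mult_left_mono)
      have "Gamma_series s n / Gamma_series (s + \<alpha>) n = pochhammer (s + \<alpha>) k / (e * pochhammer s k)"
        using pos[of k] by (simp add: Gamma_series_def e_def Suc exp_add distrib_right)
      then have "pochhammer (s + \<alpha>) k / (e * pochhammer s k) \<le> B"
        using order_trans[OF abs_ge_self B(2)[of n, unfolded real_norm_def]] by simp
      then have "pochhammer (s + \<alpha>) k \<le> B * (e * pochhammer s k)"
        using pos(1)[of k] e by (simp add: field_simps)
      also have "\<dots> \<le> max B 1 * ((real k + 1) powr \<alpha> * pochhammer s k)"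
        using pos[of k] e B(1) \<open>e \<le> _\<close> by (intro mult_mono) auto
      finally show ?thesis by (simp add: mult.assoc)
    qed auto
  qed simp
qed

text \<open>The signs in the binomial coefficient of -\<gamma> and in the power of -z cancel. For
  \<gamma> > 0 this leaves nonnegative coefficients, so that termwise moduli lose nothing in
  them.\<close>

lemma neg_binomial_series_complex:
  fixes z :: complex and \<gamma> :: real
  assumes "cmod z < 1"
  shows "(\<lambda>n. of_real (pochhammer \<gamma> n / fact n) * z ^ n) sums (1 / (1 - z) powr of_real \<gamma>)"
proof -
  have "(\<lambda>n. ((- of_real \<gamma>) gchoose n) * (- z) ^ n) sums (1 + (- z)) powr (- of_real \<gamma>)"
    by (rule gen_binomial_complex) (use assms in simp)
  moreover have "((- of_real \<gamma>) gchoose n) * (- z) ^ n = of_real (pochhammer \<gamma> n / fact n) * z ^ n" for n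
  proof -
    have "(- z) ^ n = (- 1) ^ n * z ^ n" by (rule power_minus)
    moreover have "(- 1 :: complex) ^ n * (- 1) ^ n = 1" by (rule minus_one_mult_self)
    ultimately show ?thesis
      by (simp add: gbinomial_pochhammer pochhammer_of_real mult_ac)
  qed
  ultimately show ?thesis by (simp add: powr_minus_divide)
qed

lemma neg_binomial_series_real:
  fixes x \<gamma> :: real
  assumes "\<bar>x\<bar> < 1"
  shows "(\<lambda>n. pochhammer \<gamma> n / fact n * x ^ n) sums ((1 - x) powr (- \<gamma>))"
proof -
  have "(\<lambda>n. ((- \<gamma>) gchoose n) * (- x) ^ n) sums (1 + (- x)) powr (- \<gamma>)"
    by (rule gen_binomial_real) (use assms in simp)
  moreover have "((- \<gamma>) gchoose n) * (- x) ^ n = pochhammer \<gamma> n / fact n * x ^ n" for n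
  proof -
    have "(- x) ^ n = (- 1) ^ n * x ^ n" by (rule power_minus)
    moreover have "(- 1 :: real) ^ n * (- 1) ^ n = 1" by (rule minus_one_mult_self)
    ultimately show ?thesis by (simp add: gbinomial_pochhammer mult_ac)
  qed
  ultimately show ?thesis by simp
qed

text \<open>With t = (n + 1)(1 - x) the left-hand side is at most a constant times t to the power
  \<alpha> times exp (1 - t), because x \<le> exp (x - 1). The inequality t/\<alpha> \<le> exp
  (t/\<alpha>), raised to the power \<alpha>, bounds this independently of n and x.\<close>

lemma monomial_weight_bound:
  fixes \<alpha> x :: real
  assumes "0 < \<alpha>" "0 \<le> x" "x < 1"
  shows "(1 - x\<^sup>2) powr \<alpha> * ((real n + 1) powr \<alpha> * x ^ n) \<le> 2 powr \<alpha> * exp 1 * \<alpha> powr \<alpha>"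
proof -
  define t where "t = (real n + 1) * (1 - x)"
  have t: "0 < t" using assms by (simp add: t_def)
  have xn: "x ^ n \<le> exp (1 - t)"
  proof -
    have "x ^ n \<le> exp (x - 1) ^ n"
      using exp_ge_add_one_self[of "x - 1"] assms(2) by (intro power_mono) auto
    also have "\<dots> = exp (real n * (x - 1))" by (simp add: exp_of_nat_mult)
    also have "\<dots> \<le> exp (1 - t)" using assms(2) by (simp add: t_def algebra_simps)
    finally show ?thesis .
  qed
  have "t / \<alpha> \<le> exp (t / \<alpha>)" using exp_ge_add_one_self[of "t / \<alpha>"] by linarith
  then have "(t / \<alpha>) powr \<alpha> \<le> exp (t / \<alpha>) powr \<alpha>" using assms t by (intro powr_mono2) auto
  then have tt: "t powr \<alpha> \<le> exp t * \<alpha> powr \<alpha>"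
    using assms t by (simp add: powr_def[of "exp _"] powr_divide field_simps)
  have "1 - x\<^sup>2 \<le> 2 * (1 - x)" "0 \<le> 1 - x\<^sup>2"
    using one_minus_norm_le_weight[of "of_real x"] assms by auto
  then have "(1 - x\<^sup>2) powr \<alpha> * ((real n + 1) powr \<alpha> * x ^ n)
      \<le> (2 * (1 - x)) powr \<alpha> * ((real n + 1) powr \<alpha> * exp (1 - t))"
    using assms xn by (intro mult_mono powr_mono2) auto
  also have "\<dots> = 2 powr \<alpha> * exp (1 - t) * t powr \<alpha>"
    using assms by (simp add: t_def powr_mult del: right_diff_distrib_numeral)
  also have "\<dots> \<le> 2 powr \<alpha> * exp (1 - t) * (exp t * \<alpha> powr \<alpha>)"
    using tt by (intro mult_left_mono) auto
  also have "\<dots> = 2 powr \<alpha> * exp 1 * \<alpha> powr \<alpha>" by (simp add: exp_diff)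
  finally show ?thesis .
qed

text \<open>Write x^n as the square of (sqrt x)^n: one factor absorbs the growth of the power of n +
  1, the other tends to 0.\<close>

lemma tendsto_powr_mult_power_0:
  fixes x \<alpha> :: real
  assumes "0 < \<alpha>" "0 \<le> x" "x < 1"
  shows "(\<lambda>n. (real n + 1) powr \<alpha> * x ^ n) \<longlonglongrightarrow> 0"
proof (cases "x = 0")
  case True
  have "\<forall>\<^sub>F n in sequentially. (real n + 1) powr \<alpha> * x ^ n = 0"
    using eventually_gt_at_top[of 0] by eventually_elim (simp add: True)
  then show ?thesis by (rule tendsto_eventually)
next
  case False
  define K where "K = 2 powr \<alpha> * exp 1 * \<alpha> powr \<alpha> / (1 - (sqrt x)\<^sup>2) powr \<alpha>"
  have le: "(real n + 1) powr \<alpha> * x ^ n \<le> K * sqrt x ^ n" for n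
  proof -
    have "(real n + 1) powr \<alpha> * sqrt x ^ n \<le> K"
      using monomial_weight_bound[of \<alpha> "sqrt x" n] assms by (simp add: K_def field_simps)
    then have "(real n + 1) powr \<alpha> * sqrt x ^ n * sqrt x ^ n \<le> K * sqrt x ^ n"
      using assms by (intro mult_right_mono) auto
    moreover have "sqrt x ^ n * sqrt x ^ n = x ^ n"
      using assms by (simp flip: power_mult_distrib)
    ultimately show ?thesis by (simp add: mult.assoc)
  qed
  have "(\<lambda>n. K * sqrt x ^ n) \<longlonglongrightarrow> 0"
    using assms by (intro tendsto_mult_right_zero LIMSEQ_power_zero) auto
  then show ?thesis
    by (rule tendsto_sandwich[OF _ _ tendsto_const, rotated 2])
       (use assms le in \<open>auto intro!: always_eventually\<close>)
qed

section \<open>Test functions and the difference operator\<close>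

text \<open>The integrand of \<open>test_f\<close>, hence its derivative on the disk, which is all
  that the operators see of it.\<close>

definition kernel_f :: "real \<Rightarrow> complex \<Rightarrow> complex \<Rightarrow> complex" where
  "kernel_f \<alpha> a u = of_real ((1 - (cmod a)\<^sup>2) powr \<alpha>) / (1 - cnj a * u) powr of_real (2 * \<alpha>)"

definition kernel_g :: "real \<Rightarrow> complex \<Rightarrow> complex \<Rightarrow> complex" where
  "kernel_g \<alpha> a u = kernel_f \<alpha> a u * ((a - u) / (1 - cnj a * u))"

lemma test_f_kernel: "test_f \<alpha> a = disk_primitive (kernel_f \<alpha> a)"
  by (simp add: test_f_def kernel_f_def[abs_def])

lemma test_g_kernel: "test_g \<alpha> a = disk_primitive (kernel_g \<alpha> a)"
  by (simp add: test_g_def kernel_f_def kernel_g_def[abs_def])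

text \<open>Keeps the base of the complex power off the cut of the principal branch.\<close>

lemma Re_one_minus_cnj_mult_pos:
  assumes "a \<in> unit_disk" "u \<in> unit_disk"
  shows "0 < Re (1 - cnj a * u)"
  using disk_mult_less_1[OF assms] complex_Re_le_cmod[of "cnj a * u"] by simp

lemma kernel_f_holomorphic:
  assumes "a \<in> unit_disk"
  shows "kernel_f \<alpha> a holomorphic_on unit_disk"
proof -
  have "1 - cnj a * u \<notin> \<real>\<^sub>\<le>\<^sub>0" if "u \<in> unit_disk" for u
    using Re_one_minus_cnj_mult_pos[OF assms that] complex_nonpos_Reals_iff by fastforce
  moreover have "1 - cnj a * u \<noteq> 0" if "u \<in> unit_disk" for u
    by (rule one_minus_cnj_mult_nonzero[OF assms that])
  ultimately show ?thesis
    unfolding kernel_f_def by (intro holomorphic_intros) auto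
qed

lemma kernel_g_holomorphic:
  assumes "a \<in> unit_disk"
  shows "kernel_g \<alpha> a holomorphic_on unit_disk"
  unfolding kernel_g_def
  using one_minus_cnj_mult_nonzero[OF assms]
  by (intro holomorphic_intros kernel_f_holomorphic assms) auto

lemma norm_mobius_eq_pdist: "cmod ((a - u) / (1 - cnj a * u)) = pdist a u"
  by (subst pdist_commute) (simp add: pdist_def)

text \<open>For a real exponent the modulus of the complex power is the power of the modulus, and
  the remaining quotient is the one in \<open>one_minus_pdist_sq\<close>.\<close>

lemma weighted_norm_kernel_f:
  assumes "a \<in> unit_disk" "u \<in> unit_disk"
  shows "(1 - (cmod u)\<^sup>2) powr \<alpha> * cmod (kernel_f \<alpha> a u) = (1 - (pdist a u)\<^sup>2) powr \<alpha>"
proof -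
  have nz: "0 < cmod (1 - cnj a * u)" using one_minus_cnj_mult_nonzero[OF assms] by simp
  have "cmod ((1 - cnj a * u) powr of_real (2 * \<alpha>)) = cmod (1 - cnj a * u) powr (2 * \<alpha>)"
    by (simp add: norm_powr_real_powr')
  also have "\<dots> = (cmod (1 - cnj a * u))\<^sup>2 powr \<alpha>"
    using nz by (simp add: powr_powr flip: powr_numeral)
  finally have "cmod (kernel_f \<alpha> a u)
      = (1 - (cmod a)\<^sup>2) powr \<alpha> / (cmod (1 - cnj a * u))\<^sup>2 powr \<alpha>"
    by (simp add: kernel_f_def norm_divide)
  then show ?thesis
    unfolding one_minus_pdist_sq[OF assms]
    using weight_pos[OF assms(1)] weight_pos[OF assms(2)] nz
    by (simp add: powr_mult powr_divide)
qed

lemma weighted_norm_kernel_f_le_1: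
  assumes "0 < \<alpha>" "a \<in> unit_disk" "u \<in> unit_disk"
  shows "(1 - (cmod u)\<^sup>2) powr \<alpha> * cmod (kernel_f \<alpha> a u) \<le> 1"
  unfolding weighted_norm_kernel_f[OF assms(2,3)]
  using assms(1) pdist_le_1[OF assms(2,3)] by (intro powr_le1) (auto simp: abs_square_le_1)

lemma norm_kernel_g: "cmod (kernel_g \<alpha> a u) = cmod (kernel_f \<alpha> a u) * pdist a u"
  unfolding kernel_g_def norm_mult norm_mobius_eq_pdist ..

lemma weighted_norm_kernel_g_le_1:
  assumes "0 < \<alpha>" "a \<in> unit_disk" "u \<in> unit_disk"
  shows "(1 - (cmod u)\<^sup>2) powr \<alpha> * cmod (kernel_g \<alpha> a u) \<le> 1"
  using mult_mono[OF weighted_norm_kernel_f_le_1[OF assms] pdist_le_1[OF assms(2,3)]]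
  by (simp add: norm_kernel_g mult.assoc)

text \<open>At u = a the base of the power is the positive real 1 - |a|^2, so the value is 1 itself
  and not only of modulus 1. Subtracting quotients from each other relies on the absence of a
  phase.\<close>

lemma kernel_f_diagonal:
  assumes "a \<in> unit_disk"
  shows "of_real ((1 - (cmod a)\<^sup>2) powr \<alpha>) * kernel_f \<alpha> a a = 1"
proof -
  let ?w = "1 - (cmod a)\<^sup>2"
  have w: "0 < ?w" by (rule weight_pos[OF assms])
  have "1 - cnj a * a = of_real ?w"
    by (simp only: of_real_diff complex_norm_square of_real_1 mult.commute)
  then have "(1 - cnj a * a) powr of_real (2 * \<alpha>) = of_real (?w powr (2 * \<alpha>))"
    using w by (simp only: powr_of_real)
  also have "?w powr (2 * \<alpha>) = ?w powr \<alpha> * ?w powr \<alpha>"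
    by (simp flip: powr_add)
  finally show ?thesis using w by (simp add: kernel_f_def)
qed

lemma kernel_g_diagonal: "kernel_g \<alpha> a a = 0"
  by (simp add: kernel_g_def)

text \<open>
  Since \<open>cnj a * (a - u) = (1 - cnj a * u) - (1 - |a|\<^sup>2)\<close>, the second kernel is a combination of
  two negative powers of \<open>1 - cnj a * u\<close>, whose power series can be estimated termwise; the series
  of the product itself has coefficients that cancel.
\<close>

lemma kernel_g_eq:
  assumes "a \<in> unit_disk" "a \<noteq> 0" "u \<in> unit_disk"
  shows "kernel_g \<alpha> a u = (kernel_f \<alpha> a u -
    of_real ((1 - (cmod a)\<^sup>2) powr (\<alpha> + 1)) * (1 / (1 - cnj a * u) powr of_real (2 * \<alpha> + 1))) / cnj a"
proof -
  define x where "x = 1 - cnj a * u"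
  have x: "x \<noteq> 0" using one_minus_cnj_mult_nonzero[OF assms(1,3)] by (simp add: x_def)
  have w: "0 < 1 - (cmod a)\<^sup>2" by (rule weight_pos[OF assms(1)])
  have e1: "of_real ((1 - (cmod a)\<^sup>2) powr (\<alpha> + 1))
      = (of_real ((1 - (cmod a)\<^sup>2) powr \<alpha>) * of_real (1 - (cmod a)\<^sup>2) :: complex)"
    using w by (simp add: powr_add)
  have e2: "x powr of_real (2 * \<alpha> + 1) = x powr of_real (2 * \<alpha>) * x"
    using x by (simp add: powr_add)
  define r where "r = complex_of_real (1 - (cmod a)\<^sup>2)"
  have "cnj a * (a - u) = x - r"
    unfolding r_def of_real_diff complex_norm_square by (simp add: x_def algebra_simps)
  then have au: "a - u = (x - r) / cnj a"
    using assms(2) by (simp add: field_simps)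
  show ?thesis
    unfolding kernel_g_def kernel_f_def x_def[symmetric] e1 e2 r_def[symmetric] au
    using x assms(2) by (simp add: divide_simps) (simp add: algebra_simps)
qed

section \<open>The two pairs of symbols and their difference operator\<close>

locale bloch_symbols =
  fixes \<alpha> \<beta> :: real and \<phi> \<psi> g h :: "complex \<Rightarrow> complex"
  assumes \<alpha>_pos: "0 < \<alpha>"
    and self_\<phi>: "self_map \<phi>" and self_\<psi>: "self_map \<psi>"
    and hol_g: "g holomorphic_on unit_disk" and hol_h: "h holomorphic_on unit_disk"
    and bounded_\<phi>: "bounded_operator \<alpha> \<beta> (gen_comp \<phi> g)"
    and bounded_\<psi>: "bounded_operator \<alpha> \<beta> (gen_comp \<psi> h)"
begin

abbreviation T :: "(complex \<Rightarrow> complex) \<Rightarrow> complex \<Rightarrow> complex" where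
  "T \<equiv> gen_comp \<phi> g - gen_comp \<psi> h"

text \<open>F stands in the place of f', without being tied to a Bloch function: for F = f' this is
  the weighted derivative of \<open>T f\<close>, for a monomial it is the expression in (iv), and
  negative powers of 1 - cnj a * u can be inserted directly.\<close>

definition wdiff :: "(complex \<Rightarrow> complex) \<Rightarrow> complex \<Rightarrow> real" where
  "wdiff F z = (1 - (cmod z)\<^sup>2) powr \<beta> * cmod (F (\<phi> z) * g z - F (\<psi> z) * h z)"

text \<open>The assumptions are symmetric in the two pairs, so each estimate for \<open>Dg\<close>
  also yields the one for \<open>Dh\<close>.\<close>

lemma swap: "bloch_symbols \<alpha> \<beta> \<psi> \<phi> h g"
  using bloch_symbols_axioms by (simp add: bloch_symbols_def)

lemma T_bloch: "f \<in> bloch \<alpha> \<Longrightarrow> T f \<in> bloch \<beta>"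
  using bounded_\<phi> bounded_\<psi> unfolding bounded_operator_def
  by (subst minus_apply) (intro bloch_diff; blast)

lemma deriv_T:
  assumes "f \<in> bloch \<alpha>" "z \<in> unit_disk"
  shows "deriv (T f) z = deriv f (\<phi> z) * g z - deriv f (\<psi> z) * h z"
proof -
  have f: "f holomorphic_on unit_disk" using assms(1) by (simp add: bloch_def)
  have hol: "gen_comp \<phi> g f holomorphic_on unit_disk" "gen_comp \<psi> h f holomorphic_on unit_disk"
    unfolding gen_comp_def
    by (intro disk_primitive_holomorphic gen_comp_integrand_holomorphic
        self_\<phi> self_\<psi> hol_g hol_h f)+
  show ?thesis
    by (subst minus_apply)
       (simp only: deriv_diff_disk[OF hol assms(2)]
          deriv_gen_comp[OF self_\<phi> hol_g f assms(2)] deriv_gen_comp[OF self_\<psi> hol_h f assms(2)])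
qed

lemma T_norm_leI:
  assumes "f \<in> bloch \<alpha>" "\<And>z. z \<in> unit_disk \<Longrightarrow> wdiff (deriv f) z \<le> K"
  shows "bloch_norm \<beta> (T f) \<le> K"
proof (rule bloch_norm_leI)
  fix z :: complex assume "z \<in> unit_disk"
  then show "(1 - (cmod z)\<^sup>2) powr \<beta> * cmod (deriv (T f) z) \<le> K"
    using assms(2) unfolding deriv_T[OF assms(1) \<open>z \<in> unit_disk\<close>] wdiff_def by blast
qed simp

lemma wdiff_le_T_norm:
  assumes "f \<in> bloch \<alpha>" "z \<in> unit_disk"
  shows "wdiff (deriv f) z \<le> bloch_norm \<beta> (T f)"
  using weighted_deriv_le_bloch_norm[OF T_bloch[OF assms(1)] assms(2)]
  unfolding deriv_T[OF assms] wdiff_def .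

abbreviation Dg :: "complex \<Rightarrow> complex" where "Dg \<equiv> D_quot \<alpha> \<beta> \<phi> g"
abbreviation Dh :: "complex \<Rightarrow> complex" where "Dh \<equiv> D_quot \<alpha> \<beta> \<psi> h"

abbreviation weighted :: "(complex \<Rightarrow> complex) \<Rightarrow> complex \<Rightarrow> complex" where
  "weighted F w \<equiv> of_real ((1 - (cmod w)\<^sup>2) powr \<alpha>) * F w"

lemma wdiff_eq_D:
  assumes "z \<in> unit_disk"
  shows "wdiff F z = cmod (Dg z * weighted F (\<phi> z) - Dh z * weighted F (\<psi> z))"
proof -
  have "0 < (1 - (cmod (\<phi> z))\<^sup>2) powr \<alpha>" "0 < (1 - (cmod (\<psi> z))\<^sup>2) powr \<alpha>"
    using weight_pos[OF self_mapD(2)[OF self_\<phi> assms]] weight_pos[OF self_mapD(2)[OF self_\<psi> assms]]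
    by simp_all
  then have "Dg z * weighted F (\<phi> z) - Dh z * weighted F (\<psi> z)
      = of_real ((1 - (cmod z)\<^sup>2) powr \<beta>) * (F (\<phi> z) * g z - F (\<psi> z) * h z)"
    by (simp add: D_quot_def field_simps)
  then show ?thesis by (simp only: wdiff_def norm_mult norm_of_real) simp
qed

lemma test_f_bloch:
  assumes "a \<in> unit_disk"
  shows "test_f \<alpha> a \<in> bloch \<alpha>" "bloch_norm \<alpha> (test_f \<alpha> a) \<le> 1"
  unfolding test_f_kernel
  by (rule disk_primitive_bloch[OF kernel_f_holomorphic[OF assms]
        weighted_norm_kernel_f_le_1[OF \<alpha>_pos assms]], assumption)+

lemma test_g_bloch:
  assumes "a \<in> unit_disk"
  shows "test_g \<alpha> a \<in> bloch \<alpha>" "bloch_norm \<alpha> (test_g \<alpha> a) \<le> 1"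
  unfolding test_g_kernel
  by (rule disk_primitive_bloch[OF kernel_g_holomorphic[OF assms]
        weighted_norm_kernel_g_le_1[OF \<alpha>_pos assms]], assumption)+

lemma deriv_test_f: "\<lbrakk>a \<in> unit_disk; u \<in> unit_disk\<rbrakk> \<Longrightarrow> deriv (test_f \<alpha> a) u = kernel_f \<alpha> a u"
  unfolding test_f_kernel by (intro deriv_disk_primitive kernel_f_holomorphic)

lemma deriv_test_g: "\<lbrakk>a \<in> unit_disk; u \<in> unit_disk\<rbrakk> \<Longrightarrow> deriv (test_g \<alpha> a) u = kernel_g \<alpha> a u"
  unfolding test_g_kernel by (intro deriv_disk_primitive kernel_g_holomorphic)

lemma wdiff_cong:
  assumes "z \<in> unit_disk" "\<And>u. u \<in> unit_disk \<Longrightarrow> F u = G u"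
  shows "wdiff F z = wdiff G z"
  unfolding wdiff_def
  using assms(2)[OF self_mapD(2)[OF self_\<phi> assms(1)]] assms(2)[OF self_mapD(2)[OF self_\<psi> assms(1)]]
  by simp

text \<open>Apply the single operator to f_a with a = \<open>\<phi> z\<close>: by the diagonal value
  of the kernel, its weighted derivative at z has modulus exactly |Dg z|, while f_a has norm at most
  1.\<close>

lemma Dg_bounded: obtains M where "0 \<le> M" "\<And>z. z \<in> unit_disk \<Longrightarrow> cmod (Dg z) \<le> M"
proof -
  obtain C where C: "\<And>f. f \<in> bloch \<alpha> \<Longrightarrow> bloch_norm \<beta> (gen_comp \<phi> g f) \<le> C * bloch_norm \<alpha> f"
    and mem: "\<And>f. f \<in> bloch \<alpha> \<Longrightarrow> gen_comp \<phi> g f \<in> bloch \<beta>"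
    using bounded_\<phi> unfolding bounded_operator_def by blast
  show ?thesis
  \<comment> \<open>The constant in \<open>bounded_operator\<close> carries no sign, hence the
    absolute value.\<close>
  proof (rule that[of "\<bar>C\<bar>"])
    fix z :: complex assume z: "z \<in> unit_disk"
    define a where "a = \<phi> z"
    have a: "a \<in> unit_disk" using self_mapD(2)[OF self_\<phi> z] by (simp only: a_def)
    note f = test_f_bloch[OF a]
    have "cmod (of_real ((1 - (cmod a)\<^sup>2) powr \<alpha>) * kernel_f \<alpha> a a) = 1"
      by (simp only: kernel_f_diagonal[OF a] norm_one)
    then have "cmod (kernel_f \<alpha> a a) = 1 / (1 - (cmod a)\<^sup>2) powr \<alpha>"
      using weight_pos[OF a] by (simp add: norm_mult field_simps)
    then have "cmod (Dg z) = (1 - (cmod z)\<^sup>2) powr \<beta> * cmod (kernel_f \<alpha> a a * g z)"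
      by (simp add: D_quot_def norm_mult norm_divide a_def)
    also have "kernel_f \<alpha> a a * g z = deriv (gen_comp \<phi> g (test_f \<alpha> a)) z"
    proof -
      have "test_f \<alpha> a holomorphic_on unit_disk" using f by (simp add: bloch_def)
      from deriv_gen_comp[OF self_\<phi> hol_g this z] show ?thesis
        using deriv_test_f[OF a a] by (simp add: a_def)
    qed
    also have "(1 - (cmod z)\<^sup>2) powr \<beta> * cmod \<dots> \<le> bloch_norm \<beta> (gen_comp \<phi> g (test_f \<alpha> a))"
      by (rule weighted_deriv_le_bloch_norm[OF mem[OF f(1)] z])
    also have "\<dots> \<le> C * bloch_norm \<alpha> (test_f \<alpha> a)" by (rule C[OF f(1)])
    also have "\<dots> \<le> \<bar>C\<bar> * 1"
      using f bloch_norm_nonneg by (intro mult_mono) auto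
    finally show "cmod (Dg z) \<le> \<bar>C\<bar>" by simp
  qed simp
qed

lemma Dh_bounded: obtains M where "0 \<le> M" "\<And>z. z \<in> unit_disk \<Longrightarrow> cmod (Dh z) \<le> M"
  by (rule bloch_symbols.Dg_bounded[OF swap]) (rule that)

end

section \<open>Decay conditions and compactness\<close>

context bloch_symbols
begin

text \<open>Condition (ii) with one radius for all three limits; this is no loss, as each set
  shrinks when r grows.\<close>

definition D_decay :: bool where
  "D_decay \<longleftrightarrow> (\<forall>\<epsilon>>0. \<exists>r<1. \<forall>z\<in>unit_disk.
      (cmod (\<phi> z) > r \<longrightarrow> cmod (Dg z) * pdist (\<phi> z) (\<psi> z) \<le> \<epsilon>) \<and>
      (cmod (\<psi> z) > r \<longrightarrow> cmod (Dh z) * pdist (\<phi> z) (\<psi> z) \<le> \<epsilon>) \<and>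
      (cmod (\<phi> z) > r \<and> cmod (\<psi> z) > r \<longrightarrow> cmod (Dg z - Dh z) \<le> \<epsilon>))"

definition test_decay :: bool where
  "test_decay \<longleftrightarrow> (\<forall>\<epsilon>>0. \<forall>\<^sub>F a in to_circle.
      bloch_norm \<beta> (T (test_f \<alpha> a)) \<le> \<epsilon> \<and> bloch_norm \<beta> (T (test_g \<alpha> a)) \<le> \<epsilon>)"

definition power_decay :: bool where
  "power_decay \<longleftrightarrow> (\<forall>\<epsilon>>0. \<exists>N. \<forall>n\<ge>N. \<forall>z\<in>unit_disk.
      (real n + 1) powr \<alpha> * wdiff (\<lambda>u. u ^ n) z \<le> \<epsilon>)"

lemma weighted_le:
  assumes "f \<in> bloch \<alpha>" "bloch_norm \<alpha> f \<le> K" "w \<in> unit_disk"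
  shows "(1 - (cmod w)\<^sup>2) powr \<alpha> * cmod (deriv f w) \<le> K"
  using weighted_deriv_le_bloch_norm[OF assms(1,3)] assms(2) by linarith

text \<open>Exchanging the pairs reverses the order of the difference, which the norm does not
  notice; this brings estimates obtained through \<open>swap\<close> back to
  \<open>T\<close>.\<close>

lemma T_swap_norm:
  assumes "f \<in> bloch \<alpha>"
  shows "bloch_norm \<beta> ((gen_comp \<psi> h - gen_comp \<phi> g) f) = bloch_norm \<beta> (T f)"
  using bounded_\<phi> bounded_\<psi> assms unfolding bounded_operator_def
  by (subst (1 2) minus_apply) (intro bloch_norm_minus_commute; blast)

lemma wdiff_test_f_le:
  assumes "a \<in> unit_disk" "z \<in> unit_disk"
  shows "wdiff (kernel_f \<alpha> a) z \<le> bloch_norm \<beta> (T (test_f \<alpha> a))"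
  using wdiff_le_T_norm[OF test_f_bloch(1)[OF assms(1)] assms(2)]
    wdiff_cong[OF assms(2) deriv_test_f[OF assms(1)]] by simp

lemma wdiff_test_g_le:
  assumes "a \<in> unit_disk" "z \<in> unit_disk"
  shows "wdiff (kernel_g \<alpha> a) z \<le> bloch_norm \<beta> (T (test_g \<alpha> a))"
  using wdiff_le_T_norm[OF test_g_bloch(1)[OF assms(1)] assms(2)]
    wdiff_cong[OF assms(2) deriv_test_g[OF assms(1)]] by simp

lemma Dg_minus_Dh_kernel_le:
  assumes "z \<in> unit_disk"
  shows "cmod (Dg z - Dh z * weighted (kernel_f \<alpha> (\<phi> z)) (\<psi> z))
    \<le> bloch_norm \<beta> (T (test_f \<alpha> (\<phi> z)))"
  using wdiff_test_f_le[OF self_mapD(2)[OF self_\<phi> assms] assms]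
  unfolding wdiff_eq_D[OF assms] kernel_f_diagonal[OF self_mapD(2)[OF self_\<phi> assms]] by simp

text \<open>Let c be the weighted f-kernel at \<open>\<psi> z\<close>. The function f_a controls Dg
  - Dh * c; the g-kernel vanishes at \<open>\<phi> z\<close> and has an extra factor of modulus
  \<rho> at \<open>\<psi> z\<close>, so g_a controls Dh * c * \<rho>. Multiplying the first by
  \<rho> \<le> 1 and adding eliminates Dh.\<close>

lemma Dg_pdist_le:
  assumes z: "z \<in> unit_disk"
  shows "cmod (Dg z) * pdist (\<phi> z) (\<psi> z)
    \<le> bloch_norm \<beta> (T (test_f \<alpha> (\<phi> z))) + bloch_norm \<beta> (T (test_g \<alpha> (\<phi> z)))"
proof -
  let ?p = "pdist (\<phi> z) (\<psi> z)" and ?c = "weighted (kernel_f \<alpha> (\<phi> z)) (\<psi> z)"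
  have a: "\<phi> z \<in> unit_disk" and b: "\<psi> z \<in> unit_disk"
    using self_mapD(2)[OF self_\<phi> z] self_mapD(2)[OF self_\<psi> z] by blast+
  have "cmod (Dh z * ?c) * ?p = wdiff (kernel_g \<alpha> (\<phi> z)) z"
    unfolding wdiff_eq_D[OF z] kernel_g_diagonal by (simp add: norm_mult norm_kernel_g)
  also have "\<dots> \<le> bloch_norm \<beta> (T (test_g \<alpha> (\<phi> z)))"
    by (rule wdiff_test_g_le[OF a z])
  finally have g: "cmod (Dh z * ?c) * ?p \<le> bloch_norm \<beta> (T (test_g \<alpha> (\<phi> z)))" .
  have "cmod (Dg z - Dh z * ?c) * ?p \<le> cmod (Dg z - Dh z * ?c) * 1"
    by (rule mult_left_mono[OF pdist_le_1[OF a b]]) simp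
  then have f: "cmod (Dg z - Dh z * ?c) * ?p \<le> bloch_norm \<beta> (T (test_f \<alpha> (\<phi> z)))"
    using Dg_minus_Dh_kernel_le[OF z] by linarith
  have "cmod (Dg z) * ?p \<le> (cmod (Dg z - Dh z * ?c) + cmod (Dh z * ?c)) * ?p"
    using norm_triangle_sub[of "Dg z" "Dh z * ?c"] by (intro mult_right_mono) auto
  then show ?thesis using f g by (simp only: distrib_right)
qed

lemma Dh_pdist_le:
  assumes z: "z \<in> unit_disk"
  shows "cmod (Dh z) * pdist (\<phi> z) (\<psi> z)
    \<le> bloch_norm \<beta> (T (test_f \<alpha> (\<psi> z))) + bloch_norm \<beta> (T (test_g \<alpha> (\<psi> z)))"
proof -
  have b: "\<psi> z \<in> unit_disk" by (rule self_mapD(2)[OF self_\<psi> z])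
  show ?thesis
    using bloch_symbols.Dg_pdist_le[OF swap z]
    unfolding T_swap_norm[OF test_f_bloch(1)[OF b]] T_swap_norm[OF test_g_bloch(1)[OF b]]
      pdist_commute[of "\<psi> z"] .
qed

lemma test_decay_imp_D_decay:
  assumes test_decay
  shows D_decay
  unfolding D_decay_def
proof (intro allI impI)
  fix \<epsilon> :: real assume "\<epsilon> > 0"
  obtain C where C: "0 \<le> C"
    "\<And>F K a b. \<lbrakk>F holomorphic_on unit_disk;
        \<And>w. w \<in> unit_disk \<Longrightarrow> (1 - (cmod w)\<^sup>2) powr \<alpha> * cmod (F w) \<le> K;
        a \<in> unit_disk; b \<in> unit_disk\<rbrakk> \<Longrightarrow>
      cmod (weighted F a - weighted F b) \<le> C * K * pdist a b"
    using weighted_lipschitz[OF \<alpha>_pos] by metis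
  \<comment> \<open>Each of the first two conditions costs 2 * e, one e per test family. The third
    costs e from f_a and C * (2 * e) for replacing the kernel value at \<open>\<psi> z\<close> by
    1.\<close>
  define e where "e = \<epsilon> / (2 + 2 * C)"
  have C2: "0 < 2 + 2 * C" using C(1) by simp
  have "e > 0" using C2 \<open>\<epsilon> > 0\<close> by (simp add: e_def)
  moreover have "e * (2 + 2 * C) = \<epsilon>" using C2 by (simp add: e_def)
  ultimately have e: "e > 0" "2 * e + 2 * C * e = \<epsilon>" by (simp_all add: algebra_simps)
  obtain r where r: "r < 1"
    "\<And>a. r < cmod a \<Longrightarrow> cmod a < 1 \<Longrightarrow>
      bloch_norm \<beta> (T (test_f \<alpha> a)) \<le> e \<and> bloch_norm \<beta> (T (test_g \<alpha> a)) \<le> e"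
    using assms e(1) unfolding test_decay_def eventually_to_circle by metis
  have Ce: "0 \<le> C * e" using C(1) e(1) by simp
  have "(cmod (\<phi> z) > r \<longrightarrow> cmod (Dg z) * pdist (\<phi> z) (\<psi> z) \<le> \<epsilon>) \<and>
      (cmod (\<psi> z) > r \<longrightarrow> cmod (Dh z) * pdist (\<phi> z) (\<psi> z) \<le> \<epsilon>) \<and>
      (cmod (\<phi> z) > r \<and> cmod (\<psi> z) > r \<longrightarrow> cmod (Dg z - Dh z) \<le> \<epsilon>)"
    if z: "z \<in> unit_disk" for z
  proof (intro conjI impI)
    have a: "\<phi> z \<in> unit_disk" and b: "\<psi> z \<in> unit_disk"
      using self_mapD(2)[OF self_\<phi> z] self_mapD(2)[OF self_\<psi> z] by blast+
    then have ab: "cmod (\<phi> z) < 1" "cmod (\<psi> z) < 1" by simp_all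
    {
      assume "cmod (\<phi> z) > r"
      from Dg_pdist_le[OF z] r(2)[OF this ab(1)] Ce e
      show "cmod (Dg z) * pdist (\<phi> z) (\<psi> z) \<le> \<epsilon>" by linarith
    }
    {
      assume "cmod (\<psi> z) > r"
      from Dh_pdist_le[OF z] r(2)[OF this ab(2)] Ce e
      show "cmod (Dh z) * pdist (\<phi> z) (\<psi> z) \<le> \<epsilon>" by linarith
    }
    assume *: "cmod (\<phi> z) > r \<and> cmod (\<psi> z) > r"
    let ?p = "pdist (\<phi> z) (\<psi> z)" and ?c = "weighted (kernel_f \<alpha> (\<phi> z)) (\<psi> z)"
    \<comment> \<open>The weighted kernel is 1 at \<open>\<phi> z\<close>, so the Lipschitz estimate
      puts its value at \<open>\<psi> z\<close> within C\<rho> of 1; the factor \<rho> is what the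
      decay of \<open>Dh\<close> requires.\<close>
    have "cmod (1 - ?c) \<le> C * 1 * ?p"
      using C(2)[OF kernel_f_holomorphic[OF a] weighted_norm_kernel_f_le_1[OF \<alpha>_pos a] a b]
      unfolding kernel_f_diagonal[OF a] .
    then have "cmod (Dh z * (1 - ?c)) \<le> cmod (Dh z) * (C * ?p)"
      by (simp add: norm_mult mult_left_mono)
    also have "\<dots> = C * (cmod (Dh z) * ?p)" by simp
    also have "\<dots> \<le> C * (2 * e)"
      using Dh_pdist_le[OF z] r(2)[of "\<psi> z"] * ab C(1) by (intro mult_left_mono) auto
    finally have 1: "cmod (Dh z * (1 - ?c)) \<le> 2 * C * e" by simp
    have "Dg z - Dh z = (Dg z - Dh z * ?c) - Dh z * (1 - ?c)" by (simp add: algebra_simps)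
    then have "cmod (Dg z - Dh z) \<le> cmod (Dg z - Dh z * ?c) + cmod (Dh z * (1 - ?c))"
      by (metis norm_triangle_ineq4)
    then show "cmod (Dg z - Dh z) \<le> \<epsilon>"
      using 1 Dg_minus_Dh_kernel_le[OF z] r(2)[of "\<phi> z"] * ab e by linarith
  qed
  then show "\<exists>r<1. \<forall>z\<in>unit_disk.
      (cmod (\<phi> z) > r \<longrightarrow> cmod (Dg z) * pdist (\<phi> z) (\<psi> z) \<le> \<epsilon>) \<and>
      (cmod (\<psi> z) > r \<longrightarrow> cmod (Dh z) * pdist (\<phi> z) (\<psi> z) \<le> \<epsilon>) \<and>
      (cmod (\<phi> z) > r \<and> cmod (\<psi> z) > r \<longrightarrow> cmod (Dg z - Dh z) \<le> \<epsilon>)"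
    using r(1) by blast
qed

text \<open>
  When only \<open>|\<phi> z|\<close> is close to 1, \<open>weighted F (\<psi> z)\<close> is small by local uniform smallness, and it
  controls \<open>weighted F (\<phi> z)\<close> up to a multiple of the pseudohyperbolic distance, which the decay
  of \<open>Dg\<close> absorbs.
\<close>

lemma D_decay_imp_T_small:
  assumes D_decay "0 \<le> K" "0 < \<epsilon>"
  shows "\<exists>r<1. \<exists>\<eta>>0. \<forall>f\<in>bloch \<alpha>. bloch_norm \<alpha> f \<le> K \<longrightarrow>
    (\<forall>w\<in>cball 0 r. cmod (deriv f w) \<le> \<eta>) \<longrightarrow> bloch_norm \<beta> (T f) \<le> \<epsilon>"
proof -
  obtain C where C: "0 \<le> C"
    "\<And>F K a b. \<lbrakk>F holomorphic_on unit_disk;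
        \<And>w. w \<in> unit_disk \<Longrightarrow> (1 - (cmod w)\<^sup>2) powr \<alpha> * cmod (F w) \<le> K;
        a \<in> unit_disk; b \<in> unit_disk\<rbrakk> \<Longrightarrow>
      cmod (weighted F a - weighted F b) \<le> C * K * pdist a b"
    using weighted_lipschitz[OF \<alpha>_pos] by metis
  obtain M1 where M1: "0 \<le> M1" "\<And>z. z \<in> unit_disk \<Longrightarrow> cmod (Dg z) \<le> M1"
    by (rule Dg_bounded) (rule that)
  obtain M2 where M2: "0 \<le> M2" "\<And>z. z \<in> unit_disk \<Longrightarrow> cmod (Dh z) \<le> M2"
    by (rule Dh_bounded) (rule that)
  \<comment> \<open>Half of \<epsilon> pays, through e, for the Lipschitz error and for Dg - Dh; the
    other half pays, through \<eta>, for bounded quotients times small values. The added 1 keeps the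
    denominators positive.\<close>
  define e where "e = \<epsilon> / (2 * (C * K + K + 1))"
  define \<eta> where "\<eta> = \<epsilon> / (2 * (M1 + M2 + 1))"
  have CK: "0 \<le> C * K" using C(1) \<open>0 \<le> K\<close> by simp
  have e: "0 < e" "(C * K + K + 1) * e = \<epsilon> / 2"
    using CK assms by (auto simp: e_def field_simps intro!: divide_pos_pos)
  have \<eta>: "0 < \<eta>" "(M1 + M2 + 1) * \<eta> = \<epsilon> / 2"
    using M1(1) M2(1) \<open>0 < \<epsilon>\<close> by (auto simp: \<eta>_def field_simps intro!: divide_pos_pos)
  obtain r where r: "r < 1"
    and rf: "\<And>z. z \<in> unit_disk \<Longrightarrow> cmod (\<phi> z) > r \<Longrightarrow> cmod (Dg z) * pdist (\<phi> z) (\<psi> z) \<le> e"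
    and rg: "\<And>z. z \<in> unit_disk \<Longrightarrow> cmod (\<psi> z) > r \<Longrightarrow> cmod (Dh z) * pdist (\<phi> z) (\<psi> z) \<le> e"
    and rfg: "\<And>z. z \<in> unit_disk \<Longrightarrow> cmod (\<phi> z) > r \<Longrightarrow> cmod (\<psi> z) > r \<Longrightarrow> cmod (Dg z - Dh z) \<le> e"
    using \<open>D_decay\<close> e(1) unfolding D_decay_def by metis
  have "bloch_norm \<beta> (T f) \<le> \<epsilon>"
    if f: "f \<in> bloch \<alpha>" "bloch_norm \<alpha> f \<le> K" and small: "\<forall>w\<in>cball 0 r. cmod (deriv f w) \<le> \<eta>" for f
  proof (rule T_norm_leI[OF f(1)])
    fix z :: complex assume z: "z \<in> unit_disk"
    have a: "\<phi> z \<in> unit_disk" and b: "\<psi> z \<in> unit_disk"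
      using self_mapD(2)[OF self_\<phi> z] self_mapD(2)[OF self_\<psi> z] by blast+
    let ?p = "pdist (\<phi> z) (\<psi> z)"
    define P where "P = weighted (deriv f) (\<phi> z)"
    define Q where "Q = weighted (deriv f) (\<psi> z)"
    have PQ: "cmod (P - Q) \<le> C * K * ?p"
      unfolding P_def Q_def by (rule C(2)[OF deriv_holomorphic_of_bloch[OF f(1)] weighted_le[OF f] a b])
    have PK: "cmod P \<le> K"
      using weighted_le[OF f a] by (simp add: P_def norm_mult)
    have small': "cmod (weighted (deriv f) w) \<le> \<eta>" if w: "w \<in> unit_disk" "cmod w \<le> r" for w
    proof -
      have "(1 - (cmod w)\<^sup>2) powr \<alpha> \<le> 1"
        using weight_pos[OF w(1)] \<alpha>_pos by (intro powr_le1) auto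
      then have "cmod (weighted (deriv f) w) \<le> cmod (deriv f w)"
        by (simp add: norm_mult mult_left_le_one_le)
      also have "\<dots> \<le> \<eta>" using small w(2) by simp
      finally show ?thesis .
    qed
    have smallP: "cmod P \<le> \<eta>" if "cmod (\<phi> z) \<le> r" unfolding P_def by (rule small'[OF a that])
    have smallQ: "cmod Q \<le> \<eta>" if "cmod (\<psi> z) \<le> r" unfolding Q_def by (rule small'[OF b that])
    have M1\<eta>: "cmod (Dg z * x) \<le> M1 * \<eta>" if "cmod x \<le> \<eta>" for x
      using that M1(2)[OF z] M1(1) by (simp add: norm_mult mult_mono)
    have M2\<eta>: "cmod (Dh z * x) \<le> M2 * \<eta>" if "cmod x \<le> \<eta>" for x
      using that M2(2)[OF z] M2(1) by (simp add: norm_mult mult_mono)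
    have fPQ: "cmod (Dg z * (P - Q)) \<le> C * K * e" if "cmod (\<phi> z) > r"
    proof -
      have "cmod (Dg z * (P - Q)) \<le> cmod (Dg z) * (C * K * ?p)"
        using PQ by (simp add: norm_mult mult_left_mono)
      also have "\<dots> = C * K * (cmod (Dg z) * ?p)" by simp
      also have "\<dots> \<le> C * K * e" by (rule mult_left_mono[OF rf[OF z that] CK])
      finally show ?thesis .
    qed
    have gPQ: "cmod (Dh z * (P - Q)) \<le> C * K * e" if "cmod (\<psi> z) > r"
    proof -
      have "cmod (Dh z * (P - Q)) \<le> cmod (Dh z) * (C * K * ?p)"
        using PQ by (simp add: norm_mult mult_left_mono)
      also have "\<dots> = C * K * (cmod (Dh z) * ?p)" by simp
      also have "\<dots> \<le> C * K * e" by (rule mult_left_mono[OF rg[OF z that] CK])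
      finally show ?thesis .
    qed
    have pos: "0 \<le> K * e" "0 \<le> C * K * e" "0 \<le> M1 * \<eta>" "0 \<le> M2 * \<eta>"
      using CK \<open>0 \<le> K\<close> e(1) M1(1) M2(1) \<eta>(1) by simp_all
    have \<epsilon>: "C * K * e + K * e + M1 * \<eta> + M2 * \<eta> \<le> \<epsilon>"
      using e \<eta> by (simp add: distrib_right)
    have "cmod (Dg z * P - Dh z * Q) \<le> C * K * e + K * e + M1 * \<eta> + M2 * \<eta>"
    proof (cases "cmod (\<phi> z) \<le> r"; cases "cmod (\<psi> z) \<le> r")
      assume "cmod (\<phi> z) \<le> r" "cmod (\<psi> z) \<le> r"
      then show ?thesis
        using norm_triangle_ineq4[of "Dg z * P" "Dh z * Q"] M1\<eta>[OF smallP] M2\<eta>[OF smallQ] pos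
        by linarith
    next
      assume 1: "cmod (\<phi> z) \<le> r" and 2: "\<not> cmod (\<psi> z) \<le> r"
      \<comment> \<open>Only P is known to be small here. Trading Q for P leaves the error Dh * (P -
        Q), which the decay of \<open>Dh\<close> absorbs since \<open>\<psi> z\<close> is near the
        circle; the next case is the mirror image.\<close>
      have eq: "Dg z * P - Dh z * Q = Dg z * P + Dh z * (P - Q) - Dh z * P" by (simp add: algebra_simps)
      have "cmod (Dg z * P - Dh z * Q) \<le> cmod (Dg z * P) + cmod (Dh z * (P - Q)) + cmod (Dh z * P)"
        unfolding eq
        using norm_triangle_ineq4[of "Dg z * P + Dh z * (P - Q)" "Dh z * P"]
          norm_triangle_ineq[of "Dg z * P" "Dh z * (P - Q)"] by linarith
      then show ?thesis
        using M1\<eta>[OF smallP[OF 1]] M2\<eta>[OF smallP[OF 1]] gPQ 2 pos by linarith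
    next
      assume 1: "\<not> cmod (\<phi> z) \<le> r" and 2: "cmod (\<psi> z) \<le> r"
      have eq: "Dg z * P - Dh z * Q = Dg z * (P - Q) + Dg z * Q - Dh z * Q" by (simp add: algebra_simps)
      have "cmod (Dg z * P - Dh z * Q) \<le> cmod (Dg z * (P - Q)) + cmod (Dg z * Q) + cmod (Dh z * Q)"
        unfolding eq
        using norm_triangle_ineq4[of "Dg z * (P - Q) + Dg z * Q" "Dh z * Q"]
          norm_triangle_ineq[of "Dg z * (P - Q)" "Dg z * Q"] by linarith
      then show ?thesis
        using M1\<eta>[OF smallQ[OF 2]] M2\<eta>[OF smallQ[OF 2]] fPQ 1 pos by linarith
    next
      assume 1: "\<not> cmod (\<phi> z) \<le> r" and 2: "\<not> cmod (\<psi> z) \<le> r"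
      have "cmod ((Dg z - Dh z) * P) \<le> e * K"
        unfolding norm_mult using rfg[OF z] 1 2 PK e(1) by (intro mult_mono) auto
      moreover have "Dg z * P - Dh z * Q = (Dg z - Dh z) * P + Dh z * (P - Q)"
        by (simp add: algebra_simps)
      then have "cmod (Dg z * P - Dh z * Q) \<le> cmod ((Dg z - Dh z) * P) + cmod (Dh z * (P - Q))"
        by (metis norm_triangle_ineq)
      ultimately show ?thesis using gPQ 2 pos by (simp add: mult.commute)
    qed
    then show "wdiff (deriv f) z \<le> \<epsilon>"
      using \<epsilon> by (simp add: wdiff_eq_D[OF z] P_def Q_def)
  qed
  then show ?thesis
    by (intro exI[of _ r] exI[of _ \<eta>] conjI ballI impI r \<eta>(1))
qed

text \<open>Otherwise some subsequence keeps its image norms above a positive number. By compactness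
  the images along a further subsequence converge in norm to some l. Norm convergence forces
  pointwise convergence of derivatives and of values at 0, so l has derivative 0 and vanishes at 0,
  a contradiction.\<close>

lemma compact_imp_tendsto_0:
  assumes comp: "compact_operator \<alpha> \<beta> T"
    and f: "\<And>n. f n \<in> bloch \<alpha>" "\<And>n. bloch_norm \<alpha> (f n) \<le> K"
    and lim: "\<And>w. w \<in> unit_disk \<Longrightarrow> (\<lambda>n. deriv (f n) w) \<longlonglongrightarrow> 0"
  shows "(\<lambda>n. bloch_norm \<beta> (T (f n))) \<longlonglongrightarrow> 0"
proof (rule ccontr)
  interpret A: Metric_space "bloch \<alpha>" "bloch_dist \<alpha>" by (rule Metric_space_bloch)
  interpret B: Metric_space "bloch \<beta>" "bloch_dist \<beta>" by (rule Metric_space_bloch)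
  assume "\<not> (\<lambda>n. bloch_norm \<beta> (T (f n))) \<longlonglongrightarrow> 0"
  then obtain \<epsilon> where \<epsilon>: "\<epsilon> > 0"
    and "\<not> (\<forall>\<^sub>F n in sequentially. dist (bloch_norm \<beta> (T (f n))) 0 < \<epsilon>)"
    unfolding tendsto_iff by blast
  from not_eventually_sequentiallyD[OF this(2)]
  obtain s :: "nat \<Rightarrow> nat" where "strict_mono s" and s: "\<And>n. \<not> dist (bloch_norm \<beta> (T (f (s n)))) 0 < \<epsilon>"
    by metis
  have big: "\<epsilon> \<le> bloch_norm \<beta> (T (f (s n)))" for n
    using s[of n] bloch_norm_nonneg[OF T_bloch[OF f(1)]] by (simp add: dist_real_def)
  have f0: "bloch_dist \<alpha> (\<lambda>_. 0) (f n) \<le> K" for n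
  proof -
    have "bloch_dist \<alpha> (\<lambda>_. 0) (f n) = bloch_norm \<alpha> (f n - (\<lambda>_. 0))"
      using bloch_norm_minus_commute[OF zero_in_bloch f(1)] f(1) zero_in_bloch
      by (simp add: bloch_dist_def)
    also have "f n - (\<lambda>_. 0) = f n" by (simp add: fun_eq_iff)
    finally show ?thesis using f(2) by simp
  qed
  have "A.mbounded (range f)"
    unfolding A.mbounded using f(1) f0 zero_in_bloch by blast
  then have "compactin B.mtopology (B.mtopology closure_of (T ` range f))"
    using comp unfolding compact_operator_def by blast
  moreover have "range (\<lambda>n. T (f (s n))) \<subseteq> B.mtopology closure_of (T ` range f)"
  proof -
    have "T ` range f \<subseteq> B.mtopology closure_of (T ` range f)"
      using T_bloch f(1) by (intro closure_of_subset) auto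
    then show ?thesis by blast
  qed
  ultimately obtain l r where r: "strict_mono r"
    and l: "limitin B.mtopology ((\<lambda>n. T (f (s n))) \<circ> r) l sequentially"
    unfolding B.compactin_sequentially by blast
  have lB: "l \<in> bloch \<beta>" using l B.limitin_mspace by blast
  define k where "k = s \<circ> r"
  have k: "strict_mono k" using \<open>strict_mono s\<close> r by (simp add: k_def strict_mono_o)
  have TB: "T (f (k n)) - l \<in> bloch \<beta>" for n by (intro bloch_diff T_bloch f lB)
  have dist0: "(\<lambda>n. bloch_norm \<beta> (T (f (k n)) - l)) \<longlonglongrightarrow> 0"
  proof -
    have "(\<lambda>n. bloch_dist \<beta> (T (f (k n))) l) \<longlonglongrightarrow> 0"
      using l unfolding B.limitin_metric_dist_null by (simp add: k_def o_def)
    moreover have "bloch_dist \<beta> (T (f (k n))) l = bloch_norm \<beta> (T (f (k n)) - l)" for n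
      using T_bloch[OF f(1)] lB by (simp only: bloch_dist_def simp_thms if_True)
    ultimately show ?thesis by simp
  qed
  have l0: "l 0 = 0"
  proof -
    have "cmod (l 0) \<le> bloch_norm \<beta> (T (f (k n)) - l)" for n
      using norm_at_0_le_bloch_norm[OF TB[of n]] by simp
    then have "cmod (l 0) \<le> 0" by (intro LIMSEQ_le_const[OF dist0]) auto
    then show ?thesis by simp
  qed
  have dl: "deriv l z = 0" if z: "z \<in> unit_disk" for z
  proof -
    define w where "w = (1 - (cmod z)\<^sup>2) powr \<beta>"
    have w: "w > 0" using weight_pos[OF z] by (simp add: w_def)
    have hol: "T (f n) holomorphic_on unit_disk" "l holomorphic_on unit_disk" for n
      using T_bloch[OF f(1)] lB by (simp_all only: bloch_def mem_Collect_eq)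
    have "w * cmod (deriv (T (f (k n))) z - deriv l z) \<le> bloch_norm \<beta> (T (f (k n)) - l)" for n
      using weighted_deriv_le_bloch_norm[OF TB[of n] z]
      unfolding w_def deriv_diff_disk[OF hol z] .
    moreover have "(\<lambda>n. w * cmod (deriv (T (f (k n))) z - deriv l z)) \<longlonglongrightarrow> w * cmod (0 - deriv l z)"
    proof (intro tendsto_intros)
      have "(\<lambda>n. deriv (f n) (\<phi> z) * g z - deriv (f n) (\<psi> z) * h z) \<longlonglongrightarrow> 0 * g z - 0 * h z"
        by (intro tendsto_intros lim self_mapD(2)[OF self_\<phi> z] self_mapD(2)[OF self_\<psi> z])
      then have "(\<lambda>n. deriv (T (f n)) z) \<longlonglongrightarrow> 0"
        by (simp only: deriv_T[OF f(1) z] mult_zero_left diff_zero)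
      then show "(\<lambda>n. deriv (T (f (k n))) z) \<longlonglongrightarrow> 0"
        using LIMSEQ_subseq_LIMSEQ[OF _ k] by (auto simp only: o_def)
    qed
    ultimately have "w * cmod (0 - deriv l z) \<le> 0"
      using LIMSEQ_le[OF _ dist0] by blast
    then show ?thesis using w by (simp add: mult_le_0_iff)
  qed
  have "bloch_norm \<beta> l = bloch_norm \<beta> (\<lambda>_. 0)"
    using l0 dl by (intro bloch_norm_cong) auto
  also have "\<dots> = 0" by (simp add: bloch_norm_def bloch_seminorm_def)
  finally have "l z = 0" for z by (rule bloch_norm_eq_0[OF lB])
  then have "T (f (k n)) - l = T (f (k n))" for n by (simp only: fun_eq_iff minus_apply) simp
  then have "(\<lambda>n. bloch_norm \<beta> (T (f (k n)))) \<longlonglongrightarrow> 0" using dist0 by simp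
  then have "\<epsilon> \<le> 0" using big by (intro LIMSEQ_le_const) (auto simp: k_def)
  then show False using \<epsilon> by simp
qed

end

section \<open>Compactness tested on the kernels and on monomials\<close>

lemma norm_kernel_f_le:
  assumes "0 < \<alpha>" "a \<in> unit_disk" "w \<in> unit_disk"
  shows "cmod (kernel_f \<alpha> a w) \<le> (1 - (cmod a)\<^sup>2) powr \<alpha> / (1 - cmod w) powr (2 * \<alpha>)"
proof -
  have "cmod (cnj a * w) \<le> cmod w" using assms(2) by (simp add: norm_mult mult_left_le_one_le)
  then have "1 - cmod w \<le> cmod (1 - cnj a * w)"
    using norm_triangle_ineq2[of 1 "cnj a * w"] by simp
  then have "(1 - cmod w) powr (2 * \<alpha>) \<le> cmod (1 - cnj a * w) powr (2 * \<alpha>)"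
    using assms by (intro powr_mono2) auto
  moreover have "0 < (1 - cmod w) powr (2 * \<alpha>)" using assms(3) by simp
  moreover have "cmod ((1 - cnj a * w) powr of_real (2 * \<alpha>)) = cmod (1 - cnj a * w) powr (2 * \<alpha>)"
    by (simp add: norm_powr_real_powr')
  ultimately show ?thesis
    unfolding kernel_f_def norm_divide by (simp only:) (intro frac_le, simp_all)
qed

lemma kernel_f_tendsto_0:
  assumes "0 < \<alpha>" "\<And>n. a n \<in> unit_disk" "(\<lambda>n. cmod (a n)) \<longlonglongrightarrow> 1" "w \<in> unit_disk"
  shows "(\<lambda>n. kernel_f \<alpha> (a n) w) \<longlonglongrightarrow> 0"
proof (rule Lim_null_comparison)
  show "\<forall>\<^sub>F n in sequentially. cmod (kernel_f \<alpha> (a n) w)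
      \<le> (1 - (cmod (a n))\<^sup>2) powr \<alpha> / (1 - cmod w) powr (2 * \<alpha>)"
    by (intro always_eventually allI norm_kernel_f_le assms)
  have "(\<lambda>n. (1 - (cmod (a n))\<^sup>2) powr \<alpha>) \<longlonglongrightarrow> 0"
  proof (rule tendsto_zero_powrI[OF _ tendsto_const _ \<open>0 < \<alpha>\<close>])
    have "(\<lambda>n. 1 - (cmod (a n))\<^sup>2) \<longlonglongrightarrow> 1 - 1\<^sup>2" by (intro tendsto_intros assms)
    then show "(\<lambda>n. 1 - (cmod (a n))\<^sup>2) \<longlonglongrightarrow> 0" by simp
  qed (use weight_pos[OF assms(2)] in \<open>auto intro!: always_eventually less_imp_le\<close>)
  then show "(\<lambda>n. (1 - (cmod (a n))\<^sup>2) powr \<alpha> / (1 - cmod w) powr (2 * \<alpha>)) \<longlonglongrightarrow> 0"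
    by (rule tendsto_divide_zero)
qed

lemma kernel_g_tendsto_0:
  assumes "0 < \<alpha>" "\<And>n. a n \<in> unit_disk" "(\<lambda>n. cmod (a n)) \<longlonglongrightarrow> 1" "w \<in> unit_disk"
  shows "(\<lambda>n. kernel_g \<alpha> (a n) w) \<longlonglongrightarrow> 0"
proof (rule Lim_null_comparison)
  show "\<forall>\<^sub>F n in sequentially. cmod (kernel_g \<alpha> (a n) w) \<le> cmod (kernel_f \<alpha> (a n) w)"
    using pdist_le_1[OF assms(2,4)]
    by (intro always_eventually allI) (simp add: norm_kernel_g mult_left_le)
  show "(\<lambda>n. cmod (kernel_f \<alpha> (a n) w)) \<longlonglongrightarrow> 0"
    by (rule tendsto_norm_zero[OF kernel_f_tendsto_0[OF assms]])
qed

context bloch_symbols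
begin

text \<open>Passes from sequences to the filter: if the bound fails, there are bad parameters at
  distance less than 1/(n + 1) from the circle for every n.\<close>

lemma compact_imp_to_circle:
  assumes comp: "compact_operator \<alpha> \<beta> T"
    and f: "\<And>a. a \<in> unit_disk \<Longrightarrow> f a \<in> bloch \<alpha>" "\<And>a. a \<in> unit_disk \<Longrightarrow> bloch_norm \<alpha> (f a) \<le> K"
    and lim: "\<And>a w. \<lbrakk>\<And>n. a n \<in> unit_disk; (\<lambda>n. cmod (a n)) \<longlonglongrightarrow> 1; w \<in> unit_disk\<rbrakk> \<Longrightarrow>
      (\<lambda>n. deriv (f (a n)) w) \<longlonglongrightarrow> 0"
    and "0 < \<epsilon>"
  shows "\<forall>\<^sub>F a in to_circle. bloch_norm \<beta> (T (f a)) \<le> \<epsilon>"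
proof (rule ccontr)
  assume "\<not> (\<forall>\<^sub>F a in to_circle. bloch_norm \<beta> (T (f a)) \<le> \<epsilon>)"
  then have *: "\<exists>a. r < cmod a \<and> cmod a < 1 \<and> \<not> bloch_norm \<beta> (T (f a)) \<le> \<epsilon>" if "r < 1" for r
    using that unfolding eventually_to_circle by blast
  have "\<exists>a. 1 - inverse (real (Suc n)) < cmod a \<and> cmod a < 1 \<and> \<not> bloch_norm \<beta> (T (f a)) \<le> \<epsilon>" for n
    by (rule *) simp
  then obtain a where a: "\<And>n. 1 - inverse (real (Suc n)) < cmod (a n)" "\<And>n. cmod (a n) < 1"
    "\<And>n. \<epsilon> < bloch_norm \<beta> (T (f (a n)))"
    unfolding not_le by metis
  have aD: "a n \<in> unit_disk" for n using a(2) by simp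
  have "(\<lambda>n. cmod (a n)) \<longlonglongrightarrow> 1"
  proof (rule tendsto_sandwich)
    have "(\<lambda>n. 1 - inverse (real (Suc n))) \<longlonglongrightarrow> 1 - 0"
      by (intro tendsto_intros LIMSEQ_inverse_real_of_nat)
    then show "(\<lambda>n. 1 - inverse (real (Suc n))) \<longlonglongrightarrow> 1" by simp
    show "(\<lambda>n. 1) \<longlonglongrightarrow> (1::real)" by simp
  qed (intro always_eventually allI less_imp_le a)+
  then have "(\<lambda>n. bloch_norm \<beta> (T (f (a n)))) \<longlonglongrightarrow> 0"
    by (intro compact_imp_tendsto_0[OF comp f(1)[OF aD] f(2)[OF aD]] lim aD)
  then have "\<epsilon> \<le> 0" using a(3) by (intro LIMSEQ_le_const) (auto intro: less_imp_le)
  then show False using \<open>0 < \<epsilon>\<close> by simp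
qed

lemma compact_imp_test_decay:
  assumes comp: "compact_operator \<alpha> \<beta> T"
  shows test_decay
  unfolding test_decay_def
proof (intro allI impI eventually_conj)
  fix \<epsilon> :: real assume \<epsilon>: "0 < \<epsilon>"
  show "\<forall>\<^sub>F a in to_circle. bloch_norm \<beta> (T (test_f \<alpha> a)) \<le> \<epsilon>"
    by (rule compact_imp_to_circle[OF comp test_f_bloch])
       (simp_all only: deriv_test_f kernel_f_tendsto_0 \<alpha>_pos \<epsilon>)
  show "\<forall>\<^sub>F a in to_circle. bloch_norm \<beta> (T (test_g \<alpha> a)) \<le> \<epsilon>"
    by (rule compact_imp_to_circle[OF comp test_g_bloch])
       (simp_all only: deriv_test_g kernel_g_tendsto_0 \<alpha>_pos \<epsilon>)
qed

lemma wdiff_cmult: "wdiff (\<lambda>u. c * F u) z = cmod c * wdiff F z"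
proof -
  have "c * F (\<phi> z) * g z - c * F (\<psi> z) * h z = c * (F (\<phi> z) * g z - F (\<psi> z) * h z)"
    by (simp add: algebra_simps)
  then show ?thesis by (simp add: wdiff_def norm_mult)
qed

lemma wdiff_diff_le: "wdiff (\<lambda>u. F u - G u) z \<le> wdiff F z + wdiff G z"
proof -
  have "(F (\<phi> z) - G (\<phi> z)) * g z - (F (\<psi> z) - G (\<psi> z)) * h z
      = (F (\<phi> z) * g z - F (\<psi> z) * h z) - (G (\<phi> z) * g z - G (\<psi> z) * h z)"
    by (simp add: algebra_simps)
  then show ?thesis
    unfolding wdiff_def distrib_left[symmetric]
    by (simp only:) (intro mult_left_mono norm_triangle_ineq4, simp)
qed

lemma compact_imp_power_decay:
  assumes "compact_operator \<alpha> \<beta> T"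
  shows power_decay
  unfolding power_decay_def
proof (intro allI impI)
  fix \<epsilon> :: real assume "0 < \<epsilon>"
  \<comment> \<open>The factor makes the weighted suprema of the monomials bounded in n. Taking F n
    as the derivative, rather than the function, gives the exponent n of (iv) without a
    shift.\<close>
  define F where "F = (\<lambda>n u. of_real ((real n + 1) powr \<alpha>) * u ^ n :: complex)"
  define K where "K = 2 powr \<alpha> * exp 1 * \<alpha> powr \<alpha>"
  have hol: "F n holomorphic_on unit_disk" for n
    unfolding F_def by (intro holomorphic_intros)
  have nF: "cmod (F n u) = (real n + 1) powr \<alpha> * cmod u ^ n" for n u
    by (simp add: F_def norm_mult norm_power)
  have bd: "(1 - (cmod u)\<^sup>2) powr \<alpha> * cmod (F n u) \<le> K" if "u \<in> unit_disk" for n u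
    unfolding nF K_def using that by (intro monomial_weight_bound \<alpha>_pos) auto
  have f: "disk_primitive (F n) \<in> bloch \<alpha>" "bloch_norm \<alpha> (disk_primitive (F n)) \<le> K" for n
    by (rule disk_primitive_bloch[OF hol bd], assumption)+
  have "(\<lambda>n. deriv (disk_primitive (F n)) w) \<longlonglongrightarrow> 0" if w: "w \<in> unit_disk" for w
    unfolding deriv_disk_primitive[OF hol w]
    by (rule tendsto_norm_zero_cancel)
       (use w in \<open>auto simp: nF intro!: tendsto_powr_mult_power_0 \<alpha>_pos\<close>)
  then have "(\<lambda>n. bloch_norm \<beta> (T (disk_primitive (F n)))) \<longlonglongrightarrow> 0"
    by (rule compact_imp_tendsto_0[OF assms f])
  then have "\<forall>\<^sub>F n in sequentially. bloch_norm \<beta> (T (disk_primitive (F n))) < \<epsilon>"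
    using \<open>0 < \<epsilon>\<close> by (rule order_tendstoD(2))
  then obtain N where N: "\<And>n. n \<ge> N \<Longrightarrow> bloch_norm \<beta> (T (disk_primitive (F n))) < \<epsilon>"
    unfolding eventually_sequentially by blast
  have "(real n + 1) powr \<alpha> * wdiff (\<lambda>u. u ^ n) z \<le> \<epsilon>" if n: "n \<ge> N" and z: "z \<in> unit_disk" for n z
  proof -
    have "(real n + 1) powr \<alpha> * wdiff (\<lambda>u. u ^ n) z = wdiff (F n) z"
      unfolding F_def wdiff_cmult by simp
    also have "\<dots> = wdiff (deriv (disk_primitive (F n))) z"
      using wdiff_cong[OF z deriv_disk_primitive[OF hol]] by simp
    also have "\<dots> \<le> bloch_norm \<beta> (T (disk_primitive (F n)))" by (rule wdiff_le_T_norm[OF f(1) z])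
    finally show ?thesis using N[OF n] by linarith
  qed
  then show "\<exists>N. \<forall>n\<ge>N. \<forall>z\<in>unit_disk. (real n + 1) powr \<alpha> * wdiff (\<lambda>u. u ^ n) z \<le> \<epsilon>"
    by blast
qed

text \<open>Supplies a bound for the small exponents that \<open>power_decay\<close> leaves open; it
  holds because the weighted monomials are at most 1 and the quotients are bounded.\<close>

lemma wdiff_power_bounded:
  obtains M where "0 \<le> M" "\<And>n z. z \<in> unit_disk \<Longrightarrow> wdiff (\<lambda>u. u ^ n) z \<le> M"
proof -
  obtain M1 where M1: "0 \<le> M1" "\<And>z. z \<in> unit_disk \<Longrightarrow> cmod (Dg z) \<le> M1"
    by (rule Dg_bounded) (rule that)
  obtain M2 where M2: "0 \<le> M2" "\<And>z. z \<in> unit_disk \<Longrightarrow> cmod (Dh z) \<le> M2"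
    by (rule Dh_bounded) (rule that)
  have le1: "cmod (weighted (\<lambda>u. u ^ n) w) \<le> 1" if "w \<in> unit_disk" for n w
  proof -
    have "(1 - (cmod w)\<^sup>2) powr \<alpha> * cmod w ^ n \<le> 1 * 1"
      using that weight_pos[OF that] \<alpha>_pos by (intro mult_mono powr_le1 power_le_one) auto
    then show ?thesis by (simp add: norm_mult norm_power)
  qed
  show ?thesis
  proof (rule that[of "M1 + M2"])
    fix n :: nat and z :: complex assume z: "z \<in> unit_disk"
    have "cmod (Dg z * weighted (\<lambda>u. u ^ n) (\<phi> z)) \<le> M1 * 1"
      unfolding norm_mult[of "Dg z"]
      using M1 le1[OF self_mapD(2)[OF self_\<phi> z]] z by (intro mult_mono) auto
    moreover have "cmod (Dh z * weighted (\<lambda>u. u ^ n) (\<psi> z)) \<le> M2 * 1"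
      unfolding norm_mult[of "Dh z"]
      using M2 le1[OF self_mapD(2)[OF self_\<psi> z]] z by (intro mult_mono) auto
    ultimately show "wdiff (\<lambda>u. u ^ n) z \<le> M1 + M2"
      unfolding wdiff_eq_D[OF z]
      using norm_triangle_ineq4[of "Dg z * weighted (\<lambda>u. u ^ n) (\<phi> z)" "Dh z * weighted (\<lambda>u. u ^ n) (\<psi> z)"]
      by linarith
  qed (use M1 M2 in simp)
qed

text \<open>
  The coefficients of \<open>(1 - x)\<close> to the power \<open>- \<gamma>\<close> exceed those of \<open>(1 - x)\<close> to the power
  \<open>- (\<gamma> - \<alpha>)\<close> by a factor of order \<open>(n + 1)\<^sup>\<alpha>\<close>, which is what the decay of the monomials pays for.
\<close>

lemma power_imp_neg_power:
  assumes power_decay "\<alpha> < \<gamma>" "0 < \<epsilon>"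
  shows "\<forall>\<^sub>F a in to_circle. \<forall>z\<in>unit_disk.
    (1 - (cmod a)\<^sup>2) powr (\<gamma> - \<alpha>) * wdiff (\<lambda>u. 1 / (1 - cnj a * u) powr of_real \<gamma>) z \<le> \<epsilon>"
proof -
  define s where "s = \<gamma> - \<alpha>"
  have s: "0 < s" "\<gamma> = s + \<alpha>" using \<open>\<alpha> < \<gamma>\<close> by (auto simp: s_def)
  obtain C where C: "0 \<le> C"
    "\<And>k. pochhammer (s + \<alpha>) k \<le> C * (real k + 1) powr \<alpha> * pochhammer s k"
    by (rule pochhammer_shift_bound[OF s(1) \<alpha>_pos]) (rule that)
  obtain M where M: "0 \<le> M" "\<And>n z. z \<in> unit_disk \<Longrightarrow> wdiff (\<lambda>u. u ^ n) z \<le> M"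
    by (rule wdiff_power_bounded) (rule that)
  define c where "c = (\<lambda>n. pochhammer \<gamma> n / fact n)"
  define d where "d = (\<lambda>n. pochhammer s n / fact n)"
  have cd: "0 \<le> c n" "0 \<le> d n" "c n \<le> C * (real n + 1) powr \<alpha> * d n" for n
    using s(1) \<alpha>_pos C(2)[of n]
    by (auto simp: s(2) c_def d_def intro!: divide_nonneg_pos pochhammer_nonneg divide_right_mono)
  \<comment> \<open>D is positive even if C = 0. The factor 2 powr s in e is the largest value that
    (1 - |a|^2)^s (1 - |a|)^(-s) can approach.\<close>
  define D where "D = C + 1"
  define e where "e = \<epsilon> / (2 * D * 2 powr s)"
  have D: "0 < D" "C \<le> D" using C(1) by (auto simp: D_def)
  have e: "0 < e" using D \<open>0 < \<epsilon>\<close> by (simp add: e_def)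
  have Ce: "C * e * 2 powr s \<le> \<epsilon> / 2"
  proof -
    have "C * e * 2 powr s \<le> D * e * 2 powr s" using D e by (intro mult_right_mono) auto
    also have "\<dots> = \<epsilon> / 2" using D by (simp add: e_def)
    finally show ?thesis .
  qed
  obtain N where N: "\<And>n z. \<lbrakk>n \<ge> N; z \<in> unit_disk\<rbrakk> \<Longrightarrow> (real n + 1) powr \<alpha> * wdiff (\<lambda>u. u ^ n) z \<le> e"
    using assms(1) e unfolding power_decay_def by metis
  define B where "B = (\<Sum>n<N. c n * M)"
  have B: "0 \<le> B" unfolding B_def using cd M(1) by (intro sum_nonneg) auto
  have main: "(1 - (cmod a)\<^sup>2) powr s * wdiff (\<lambda>u. 1 / (1 - cnj a * u) powr of_real \<gamma>) z
      \<le> B * (1 - (cmod a)\<^sup>2) powr s + \<epsilon> / 2"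
    if a: "cmod a < 1" and z: "z \<in> unit_disk" for a z
  proof -
    have aD: "a \<in> unit_disk" using a by simp
    define w where "w = complex_of_real ((1 - (cmod z)\<^sup>2) powr \<beta>)"
    define t where "t = (\<lambda>n. w * (of_real (c n) * (cnj a * \<phi> z) ^ n * g z - of_real (c n) * (cnj a * \<psi> z) ^ n * h z))"
    have series: "(\<lambda>n. of_real (c n) * (cnj a * u) ^ n) sums (1 / (1 - cnj a * u) powr of_real \<gamma>)"
      if "u \<in> unit_disk" for u
      unfolding c_def by (rule neg_binomial_series_complex[OF disk_mult_less_1[OF aD that]])
    have t: "t sums (w * (1 / (1 - cnj a * \<phi> z) powr of_real \<gamma> * g z
        - 1 / (1 - cnj a * \<psi> z) powr of_real \<gamma> * h z))"
      unfolding t_def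
      by (intro sums_mult[of _ _ w] sums_diff sums_mult2 series
          self_mapD(2)[OF self_\<phi> z] self_mapD(2)[OF self_\<psi> z])
    have nt: "cmod (t n) = c n * cmod a ^ n * wdiff (\<lambda>u. u ^ n) z" for n
    proof -
      have "t n = of_real (c n) * cnj a ^ n * (w * (\<phi> z ^ n * g z - \<psi> z ^ n * h z))"
        by (simp add: t_def power_mult_distrib algebra_simps)
      then show ?thesis
        using cd(1)[of n] by (simp add: norm_mult norm_power wdiff_def w_def)
    qed
    \<comment> \<open>The majorant: for n < N the uniform bound M is used; for the others
      \<open>power_decay\<close> absorbs the power of n + 1 by which c n exceeds d n, leaving the
      series of (1 - |a|)^(-s) with the small factor C * e.\<close>
    define b where "b = (\<lambda>n. (if n < N then c n * M else 0) + C * e * (d n * cmod a ^ n))"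
    have "cmod (t n) \<le> b n" for n
    proof (cases "n < N")
      case True
      have "cmod (t n) \<le> c n * 1 * M"
        unfolding nt using cd(1)[of n] M(2)[OF z, of n] a
        by (intro mult_mono) (auto simp: power_le_one wdiff_def)
      moreover have "0 \<le> C * e * (d n * cmod a ^ n)" using C(1) e cd(2)[of n] by simp
      ultimately show ?thesis using True by (simp add: b_def)
    next
      case False
      have "cmod (t n) \<le> (C * (real n + 1) powr \<alpha> * d n) * cmod a ^ n * wdiff (\<lambda>u. u ^ n) z"
        unfolding nt using cd(3)[of n] by (intro mult_right_mono) (auto simp: wdiff_def)
      also have "\<dots> = (C * d n * cmod a ^ n) * ((real n + 1) powr \<alpha> * wdiff (\<lambda>u. u ^ n) z)"
        by simp
      also have "\<dots> \<le> (C * d n * cmod a ^ n) * e"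
        using N[of n z] z False C(1) cd(2)[of n] by (intro mult_left_mono) auto
      finally show ?thesis using False by (simp add: b_def mult_ac)
    qed
    moreover have b: "b sums (B + C * e * (1 - cmod a) powr (- s))"
      unfolding b_def
    proof (intro sums_add sums_mult)
      show "(\<lambda>n. if n < N then c n * M else 0) sums B"
        unfolding B_def using sums_If_finite_set[of "{..<N}" "\<lambda>n. c n * M"] by simp
      show "(\<lambda>n. d n * cmod a ^ n) sums ((1 - cmod a) powr (- s))"
        unfolding d_def by (rule neg_binomial_series_real) (use a in simp)
    qed
    ultimately have "cmod (suminf t) \<le> suminf b"
      by (intro norm_suminf_le sums_summable[OF b])
    then have "wdiff (\<lambda>u. 1 / (1 - cnj a * u) powr of_real \<gamma>) z \<le> B + C * e * (1 - cmod a) powr (- s)"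
      unfolding sums_unique[OF t, symmetric] sums_unique[OF b, symmetric]
      by (simp add: wdiff_def norm_mult w_def)
    then have "(1 - (cmod a)\<^sup>2) powr s * wdiff (\<lambda>u. 1 / (1 - cnj a * u) powr of_real \<gamma>) z
        \<le> (1 - (cmod a)\<^sup>2) powr s * (B + C * e * (1 - cmod a) powr (- s))"
      by (rule mult_left_mono) simp
    also have "\<dots> = B * (1 - (cmod a)\<^sup>2) powr s + C * e * ((1 - (cmod a)\<^sup>2) powr s * (1 - cmod a) powr (- s))"
      by (simp add: algebra_simps)
    also have "(1 - (cmod a)\<^sup>2) powr s * (1 - cmod a) powr (- s) \<le> 2 powr s"
    proof -
      have "(1 - (cmod a)\<^sup>2) powr s \<le> (2 * (1 - cmod a)) powr s"
        using one_minus_norm_le_weight[OF a] a s(1) by (intro powr_mono2) auto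
      also have "\<dots> = 2 powr s * (1 - cmod a) powr s" by (rule powr_mult)
      finally show ?thesis using a by (simp add: powr_minus field_simps)
    qed
    then have "C * e * ((1 - (cmod a)\<^sup>2) powr s * (1 - cmod a) powr (- s)) \<le> \<epsilon> / 2"
      using Ce C(1) e mult_left_mono[of _ "2 powr s" "C * e"] by fastforce
    finally show ?thesis by simp
  qed
  \<comment> \<open>B is fixed once N is, so the positive power of 1 - |a|^2 removes the
    contribution of the first N terms.\<close>
  have "((\<lambda>x. B * (1 - x\<^sup>2) powr s) \<longlongrightarrow> B * 0) (at_left (1::real))"
  proof (intro tendsto_mult tendsto_const tendsto_zero_powrI[OF _ tendsto_const _ s(1)])
    have "((\<lambda>x. 1 - x\<^sup>2) \<longlongrightarrow> 1 - 1\<^sup>2) (at_left (1::real))" by (intro tendsto_intros)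
    then show "((\<lambda>x. 1 - x\<^sup>2) \<longlongrightarrow> 0) (at_left (1::real))" by simp
    have "\<forall>\<^sub>F x in at_left 1. x \<in> {0<..<1::real}" by (rule eventually_at_left_real) simp
    then show "\<forall>\<^sub>F x in at_left 1. 0 \<le> 1 - (x::real)\<^sup>2"
      by eventually_elim (auto simp: power_le_one)
  qed
  then have "\<forall>\<^sub>F x in at_left 1. B * (1 - x\<^sup>2) powr s < \<epsilon> / 2"
    using \<open>0 < \<epsilon>\<close> by (intro order_tendstoD(2)[where y = "B * 0"]) auto
  then obtain r where r: "r < 1" "\<And>x. r < x \<Longrightarrow> x < 1 \<Longrightarrow> B * (1 - x\<^sup>2) powr s < \<epsilon> / 2"
    unfolding eventually_at_left_field by blast
  show ?thesis
    unfolding eventually_to_circle s_def[symmetric]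
  proof (intro exI[of _ r] conjI allI impI ballI r(1))
    fix a z :: complex assume a: "r < cmod a \<and> cmod a < 1" and z: "z \<in> unit_disk"
    show "(1 - (cmod a)\<^sup>2) powr s * wdiff (\<lambda>u. 1 / (1 - cnj a * u) powr of_real \<gamma>) z \<le> \<epsilon>"
      using main[of a z] r(2)[of "cmod a"] a z by fastforce
  qed
qed

lemma power_imp_kernel_f:
  assumes power_decay "0 < \<epsilon>"
  shows "\<forall>\<^sub>F a in to_circle. \<forall>z\<in>unit_disk. wdiff (kernel_f \<alpha> a) z \<le> \<epsilon>"
proof -
  have "\<alpha> < 2 * \<alpha>" using \<alpha>_pos by simp
  have "kernel_f \<alpha> a = (\<lambda>u. of_real ((1 - (cmod a)\<^sup>2) powr \<alpha>) * (1 / (1 - cnj a * u) powr of_real (2 * \<alpha>)))" for a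
    by (simp add: kernel_f_def fun_eq_iff)
  then have "wdiff (kernel_f \<alpha> a) z = (1 - (cmod a)\<^sup>2) powr \<alpha> *
      wdiff (\<lambda>u. 1 / (1 - cnj a * u) powr of_real (2 * \<alpha>)) z" for a z
    by (simp only: wdiff_cmult norm_of_real) simp
  then show ?thesis
    using power_imp_neg_power[OF \<open>power_decay\<close> \<open>\<alpha> < 2 * \<alpha>\<close> \<open>0 < \<epsilon>\<close>] by simp
qed

text \<open>By \<open>kernel_g_eq\<close> both parts are instances of
  \<open>power_imp_neg_power\<close>, with \<gamma> = 2\<alpha> and \<gamma> = 2\<alpha> + 1: their
  prefactors \<alpha> and \<alpha> + 1 are exactly the exponents \<gamma> - \<alpha>.\<close>

lemma power_imp_kernel_g:
  assumes power_decay "0 < \<epsilon>"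
  shows "\<forall>\<^sub>F a in to_circle. \<forall>z\<in>unit_disk. wdiff (kernel_g \<alpha> a) z \<le> \<epsilon>"
proof -
  \<comment> \<open>Two parts of size e, times the factor 1/|a|, which is at most 2 once |a| >
    1/2.\<close>
  define e where "e = \<epsilon> / 4"
  have e: "0 < e" using \<open>0 < \<epsilon>\<close> by (simp add: e_def)
  have "\<alpha> < 2 * \<alpha> + 1" using \<alpha>_pos by simp
  have "\<forall>\<^sub>F a in to_circle. 1/2 < cmod a \<and> cmod a < 1"
    unfolding eventually_to_circle by (intro exI[of _ "1/2"]) auto
  then show ?thesis
    using power_imp_kernel_f[OF \<open>power_decay\<close> e] power_imp_neg_power[OF \<open>power_decay\<close> \<open>\<alpha> < 2 * \<alpha> + 1\<close> e]
  proof eventually_elim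
    case (elim a)
    then have a: "a \<in> unit_disk" "a \<noteq> 0" by auto
    define G where "G = (\<lambda>u. 1 / (1 - cnj a * u) powr of_real (2 * \<alpha> + 1))"
    define c where "c = (1 - (cmod a)\<^sup>2) powr (\<alpha> + 1)"
    show ?case
    proof
      fix z :: complex assume z: "z \<in> unit_disk"
      have "wdiff (kernel_g \<alpha> a) z = wdiff (\<lambda>u. (1 / cnj a) * (kernel_f \<alpha> a u - of_real c * G u)) z"
        by (rule wdiff_cong[OF z]) (simp only: kernel_g_eq[OF a], simp add: c_def G_def)
      also have "\<dots> = 1 / cmod a * wdiff (\<lambda>u. kernel_f \<alpha> a u - of_real c * G u) z"
        by (simp only: wdiff_cmult norm_divide norm_one complex_mod_cnj)
      also have "\<dots> \<le> 2 * (wdiff (kernel_f \<alpha> a) z + c * wdiff G z)"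
      proof (rule mult_mono)
        show "1 / cmod a \<le> 2" using elim(1) a(2) by (simp add: divide_le_eq mult.commute)
        show "0 \<le> wdiff (\<lambda>u. kernel_f \<alpha> a u - of_real c * G u) z" by (simp add: wdiff_def)
        have "wdiff (\<lambda>u. of_real c * G u) z = c * wdiff G z"
          by (simp only: wdiff_cmult norm_of_real) (simp add: c_def)
        then show "wdiff (\<lambda>u. kernel_f \<alpha> a u - of_real c * G u) z \<le> wdiff (kernel_f \<alpha> a) z + c * wdiff G z"
          using wdiff_diff_le[of "kernel_f \<alpha> a" "\<lambda>u. of_real c * G u" z] by simp
      qed simp
      also have "c * wdiff G z \<le> e"
        using elim(3) z by (simp add: c_def G_def add.commute)
      also have "wdiff (kernel_f \<alpha> a) z \<le> e" using elim(2) z by blast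
      also have "2 * (e + e) = \<epsilon>" by (simp add: e_def)
      finally show "wdiff (kernel_g \<alpha> a) z \<le> \<epsilon>" by simp
    qed
  qed
qed

lemma power_decay_imp_test_decay:
  assumes power_decay
  shows test_decay
  unfolding test_decay_def
proof (intro allI impI)
  fix \<epsilon> :: real assume "0 < \<epsilon>"
  have "\<forall>\<^sub>F a in to_circle. a \<in> unit_disk"
    unfolding eventually_to_circle by (intro exI[of _ 0]) auto
  then show "\<forall>\<^sub>F a in to_circle.
      bloch_norm \<beta> (T (test_f \<alpha> a)) \<le> \<epsilon> \<and> bloch_norm \<beta> (T (test_g \<alpha> a)) \<le> \<epsilon>"
    using power_imp_kernel_f[OF assms \<open>0 < \<epsilon>\<close>] power_imp_kernel_g[OF assms \<open>0 < \<epsilon>\<close>]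
  proof eventually_elim
    case (elim a)
    have "wdiff (deriv (test_f \<alpha> a)) z \<le> \<epsilon>" "wdiff (deriv (test_g \<alpha> a)) z \<le> \<epsilon>"
      if z: "z \<in> unit_disk" for z
    proof -
      have "wdiff (deriv (test_f \<alpha> a)) z = wdiff (kernel_f \<alpha> a) z"
        by (rule wdiff_cong[OF z deriv_test_f[OF elim(1)]])
      then show "wdiff (deriv (test_f \<alpha> a)) z \<le> \<epsilon>" using elim(2) z by simp
      have "wdiff (deriv (test_g \<alpha> a)) z = wdiff (kernel_g \<alpha> a) z"
        by (rule wdiff_cong[OF z deriv_test_g[OF elim(1)]])
      then show "wdiff (deriv (test_g \<alpha> a)) z \<le> \<epsilon>" using elim(3) z by simp
    qed
    then show ?case
      by (intro conjI T_norm_leI test_f_bloch(1) test_g_bloch(1) elim(1))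
  qed
qed

section \<open>Normal families and the compactness of the difference\<close>

lemma bloch_norm_diff_T:
  assumes "f \<in> bloch \<alpha>" "k \<in> bloch \<alpha>"
  shows "bloch_norm \<beta> (T f - T k) = bloch_norm \<beta> (T (f - k))"
proof (rule bloch_norm_cong)
  fix z :: complex assume z: "z \<in> unit_disk"
  have hol: "f holomorphic_on unit_disk" "k holomorphic_on unit_disk"
    "T f holomorphic_on unit_disk" "T k holomorphic_on unit_disk"
    using assms T_bloch[OF assms(1)] T_bloch[OF assms(2)]
    by (simp_all only: bloch_def mem_Collect_eq)
  \<comment> \<open>Linearity is checked only where the norm looks: at 0, where both sides vanish,
    and in the derivative on the disk.\<close>
  show "deriv (T f - T k) z = deriv (T (f - k)) z"
    unfolding deriv_diff_disk[OF hol(3,4) z] deriv_T[OF assms(1) z] deriv_T[OF assms(2) z]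
      deriv_T[OF bloch_diff[OF assms] z]
      deriv_diff_disk[OF hol(1,2) self_mapD(2)[OF self_\<phi> z]]
      deriv_diff_disk[OF hol(1,2) self_mapD(2)[OF self_\<psi> z]]
    by (simp add: algebra_simps)
qed simp

text \<open>Montel is applied to the derivatives, which the norm bounds on compact sets. The limit
  inherits the weighted bound pointwise, and k is its primitive vanishing at 0. The functions
  themselves need not converge to k, as their values at 0 are ignored; T depends on derivatives
  only.\<close>

lemma bloch_bounded_subsequence:
  assumes f: "\<And>n. f n \<in> bloch \<alpha>" "\<And>n. bloch_norm \<alpha> (f n) \<le> K"
  obtains k r where "k \<in> bloch \<alpha>" "bloch_norm \<alpha> k \<le> K" "strict_mono (r :: nat \<Rightarrow> nat)"
    "\<And>\<rho>. \<rho> < 1 \<Longrightarrow> uniform_limit (cball 0 \<rho>) (\<lambda>n. deriv (f (r n))) (deriv k) sequentially"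
proof -
  have K: "0 \<le> K" using bloch_norm_nonneg[OF f(1)] f(2) by (rule order_trans)
  obtain G r where G: "G holomorphic_on unit_disk" "strict_mono (r :: nat \<Rightarrow> nat)"
      "\<And>x. x \<in> unit_disk \<Longrightarrow> (\<lambda>n. deriv (f (r n)) x) \<longlonglongrightarrow> G x"
      "\<And>S. \<lbrakk>compact S; S \<subseteq> unit_disk\<rbrakk> \<Longrightarrow> uniform_limit S ((\<lambda>n. deriv (f n)) \<circ> r) G sequentially"
  proof (rule Montel[of unit_disk "range (\<lambda>n. deriv (f n))" "\<lambda>n. deriv (f n)"])
    fix S :: "complex set" assume S: "compact S" "S \<subseteq> unit_disk"
    show "\<exists>B. \<forall>h\<in>range (\<lambda>n. deriv (f n)). \<forall>z\<in>S. cmod (h z) \<le> B"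
    proof (cases "S = {}")
      case False
      have "continuous_on S (\<lambda>z. K / (1 - (cmod z)\<^sup>2) powr \<alpha>)"
        using S(2) weight_pos by (intro continuous_intros) force+
      from continuous_attains_sup[OF S(1) False this]
      obtain B where B: "\<And>z. z \<in> S \<Longrightarrow> K / (1 - (cmod z)\<^sup>2) powr \<alpha> \<le> B" by blast
      have "cmod (deriv (f n) z) \<le> B" if z: "z \<in> S" for n z
      proof -
        have "z \<in> unit_disk" using z S(2) by blast
        then have "cmod (deriv (f n) z) \<le> K / (1 - (cmod z)\<^sup>2) powr \<alpha>"
          using weighted_le[OF f \<open>z \<in> unit_disk\<close>] weight_pos[OF \<open>z \<in> unit_disk\<close>]
          by (simp add: field_simps)
        then show ?thesis using B[OF z] by linarith
      qed
      then show ?thesis by blast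
    qed simp
  qed (use deriv_holomorphic_of_bloch[OF f(1)] in auto)
  have bd: "(1 - (cmod z)\<^sup>2) powr \<alpha> * cmod (G z) \<le> K" if z: "z \<in> unit_disk" for z
  proof (rule LIMSEQ_le_const2)
    show "(\<lambda>n. (1 - (cmod z)\<^sup>2) powr \<alpha> * cmod (deriv (f (r n)) z))
        \<longlonglongrightarrow> (1 - (cmod z)\<^sup>2) powr \<alpha> * cmod (G z)"
      by (intro tendsto_intros G(3) z)
    show "\<exists>N. \<forall>n\<ge>N. (1 - (cmod z)\<^sup>2) powr \<alpha> * cmod (deriv (f (r n)) z) \<le> K"
      using weighted_le[OF f z] by blast
  qed
  show ?thesis
  proof (rule that[OF disk_primitive_bloch[OF G(1) bd] G(2)])
    fix \<rho> :: real assume "\<rho> < 1"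
    then have sub: "cball 0 \<rho> \<subseteq> unit_disk" by auto
    have "uniform_limit (cball 0 \<rho>) (\<lambda>n. deriv (f (r n))) G sequentially"
      using G(4)[OF compact_cball sub] by (simp add: o_def)
    then show "uniform_limit (cball 0 \<rho>) (\<lambda>n. deriv (f (r n))) (deriv (disk_primitive G)) sequentially"
      by (rule uniform_limit_cong'[THEN iffD1, rotated -1])
         (use sub deriv_disk_primitive[OF G(1)] in \<open>auto simp: subset_iff\<close>)
  qed assumption+
qed

text \<open>Compactness of the closure is checked sequentially. A sequence there is shadowed by
  images of a bounded sequence; along a Montel subsequence with limit k, the derivatives of the
  differences from k are uniformly small on a compact disk, which \<open>D_decay_imp_T_small\<close>
  turns into small norms of the images.\<close>

lemma D_decay_imp_compact:
  assumes D_decay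
  shows "compact_operator \<alpha> \<beta> T"
  unfolding compact_operator_def
proof (intro conjI allI impI)
  interpret A: Metric_space "bloch \<alpha>" "bloch_dist \<alpha>" by (rule Metric_space_bloch)
  interpret B: Metric_space "bloch \<beta>" "bloch_dist \<beta>" by (rule Metric_space_bloch)
  show "T \<in> bloch \<alpha> \<rightarrow> bloch \<beta>" using T_bloch by (rule Pi_I)
  fix S assume "A.mbounded S"
  then obtain k0 K0 where S: "S \<subseteq> A.mcball k0 K0" unfolding A.mbounded_def by blast
  define K where "K = K0 + \<bar>bloch_norm \<alpha> k0\<bar>"
  have SK: "f \<in> bloch \<alpha>" "bloch_norm \<alpha> f \<le> K" if "f \<in> S" for f
  proof -
    have f: "k0 \<in> bloch \<alpha>" "f \<in> bloch \<alpha>" "bloch_dist \<alpha> k0 f \<le> K0"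
      using S that by (auto simp: A.in_mcball)
    then show "f \<in> bloch \<alpha>" by simp
    have z: "u - (\<lambda>_. 0) = u" for u :: "complex \<Rightarrow> complex" by (simp add: fun_eq_iff)
    have "bloch_norm \<alpha> (f - k0) \<le> K0"
      using f bloch_norm_minus_commute[OF f(1,2)] by (simp add: bloch_dist_def)
    then show "bloch_norm \<alpha> f \<le> K"
      using bloch_norm_diff_triangle[OF f(2,1) zero_in_bloch] unfolding z K_def by linarith
  qed
  let ?cl = "B.mtopology closure_of (T ` S)"
  show "compactin B.mtopology ?cl"
    unfolding B.compactin_sequentially
  proof (intro conjI allI impI)
    show "?cl \<subseteq> bloch \<beta>" using closure_of_subset_topspace[of B.mtopology] by simp
    fix \<sigma> :: "nat \<Rightarrow> complex \<Rightarrow> complex" assume \<sigma>: "range \<sigma> \<subseteq> ?cl"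
    \<comment> \<open>A point of the closure need not be an image, so it is replaced by one at
      distance tending to 0 with n.\<close>
    have "\<exists>f. f \<in> S \<and> \<sigma> n \<in> bloch \<beta> \<and> bloch_dist \<beta> (\<sigma> n) (T f) < inverse (real (Suc n))" for n
    proof -
      have "\<sigma> n \<in> ?cl" using \<sigma> by blast
      moreover have "0 < inverse (real (Suc n))" by simp
      ultimately show ?thesis unfolding B.metric_closure_of B.in_mball by blast
    qed
    then obtain f where f: "\<And>n. f n \<in> S" "\<And>n. \<sigma> n \<in> bloch \<beta>"
      "\<And>n. bloch_dist \<beta> (\<sigma> n) (T (f n)) < inverse (real (Suc n))"
      by metis
    note fK = SK[OF f(1)]
    obtain k r where k: "k \<in> bloch \<alpha>" "bloch_norm \<alpha> k \<le> K" and r: "strict_mono (r :: nat \<Rightarrow> nat)"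
      and lim: "\<And>\<rho>. \<rho> < 1 \<Longrightarrow> uniform_limit (cball 0 \<rho>) (\<lambda>n. deriv (f (r n))) (deriv k) sequentially"
      by (rule bloch_bounded_subsequence[OF fK]) (rule that)
    have Tk: "T k \<in> bloch \<beta>" by (rule T_bloch[OF k(1)])
    have small: "\<forall>\<^sub>F n in sequentially. bloch_dist \<beta> (T (f (r n))) (T k) \<le> \<epsilon>" if \<epsilon>: "\<epsilon> > 0" for \<epsilon>
    proof -
      have "0 \<le> K" using bloch_norm_nonneg[OF k(1)] k(2) by linarith
      \<comment> \<open>The estimate is applied to \<open>f (r n) - k\<close>, a difference of two
        functions of norm at most K; hence 2 * K.\<close>
      obtain \<rho> \<eta> where "\<rho> < 1" "0 < \<eta>" and T: "\<And>f. \<lbrakk>f \<in> bloch \<alpha>; bloch_norm \<alpha> f \<le> 2 * K;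
          \<forall>w\<in>cball 0 \<rho>. cmod (deriv f w) \<le> \<eta>\<rbrakk> \<Longrightarrow> bloch_norm \<beta> (T f) \<le> \<epsilon>"
        using D_decay_imp_T_small[OF assms _ \<epsilon>, of "2 * K"] \<open>0 \<le> K\<close> by auto
      have "\<forall>\<^sub>F n in sequentially. \<forall>w\<in>cball 0 \<rho>. dist (deriv (f (r n)) w) (deriv k w) < \<eta>"
        by (rule uniform_limitD[OF lim[OF \<open>\<rho> < 1\<close>] \<open>0 < \<eta>\<close>])
      then show ?thesis
      proof eventually_elim
        case (elim n)
        have hol: "f (r n) holomorphic_on unit_disk" "k holomorphic_on unit_disk"
          using fK(1) k(1) by (auto simp: bloch_def)
        have "bloch_norm \<alpha> (f (r n) - k) \<le> 2 * K"
        proof -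
          have z: "u - (\<lambda>_. 0) = u" for u :: "complex \<Rightarrow> complex" by (simp add: fun_eq_iff)
          show ?thesis
            using bloch_norm_diff_triangle[OF fK(1) zero_in_bloch k(1), of "r n"]
              bloch_norm_minus_commute[OF zero_in_bloch k(1)] fK(2)[of "r n"] k(2)
            unfolding z by linarith
        qed
        moreover have "\<forall>w\<in>cball 0 \<rho>. cmod (deriv (f (r n) - k) w) \<le> \<eta>"
        proof
          fix w :: complex assume w: "w \<in> cball 0 \<rho>"
          then have "w \<in> unit_disk" using \<open>\<rho> < 1\<close> by auto
          then show "cmod (deriv (f (r n) - k) w) \<le> \<eta>"
            unfolding deriv_diff_disk[OF hol \<open>w \<in> unit_disk\<close>]
            using elim w by (auto simp: dist_norm less_imp_le)
        qed
        ultimately have "bloch_norm \<beta> (T (f (r n) - k)) \<le> \<epsilon>"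
          by (rule T[OF bloch_diff[OF fK(1) k(1)]])
        then show ?case
          using T_bloch[OF fK(1)] Tk bloch_norm_diff_T[OF fK(1) k(1)]
          by (simp only: bloch_dist_def simp_thms if_True)
      qed
    qed
    have TfD: "T (f n) \<in> bloch \<beta>" for n by (rule T_bloch[OF fK(1)])
    \<comment> \<open>The limit k need not lie in S, so membership comes from the approximating
      images and not from k itself.\<close>
    have "T k \<in> ?cl"
      unfolding B.metric_closure_of mem_Collect_eq
    proof (intro conjI allI impI Tk)
      fix \<epsilon> :: real assume "\<epsilon> > 0"
      then have "\<forall>\<^sub>F n in sequentially. bloch_dist \<beta> (T (f (r n))) (T k) \<le> \<epsilon> / 2"
        by (intro small) simp
      then obtain n where "bloch_dist \<beta> (T (f (r n))) (T k) \<le> \<epsilon> / 2"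
        unfolding eventually_sequentially by blast
      then have "T (f (r n)) \<in> B.mball (T k) \<epsilon>"
        unfolding B.in_mball using \<open>\<epsilon> > 0\<close> Tk TfD B.commute[of "T k"] by simp
      then show "\<exists>y\<in>T ` S. y \<in> B.mball (T k) \<epsilon>" using f(1) by blast
    qed
    moreover have "limitin B.mtopology (\<sigma> \<circ> r) (T k) sequentially"
      unfolding B.limitin_metric
    proof (intro conjI allI impI Tk)
      fix \<epsilon> :: real assume "\<epsilon> > 0"
      then have "\<forall>\<^sub>F n in sequentially. bloch_dist \<beta> (T (f (r n))) (T k) \<le> \<epsilon> / 2"
        by (intro small) simp
      moreover have "\<forall>\<^sub>F n in sequentially. inverse (real (Suc n)) < \<epsilon> / 2"
        using \<open>\<epsilon> > 0\<close> by (intro order_tendstoD(2)[OF LIMSEQ_inverse_real_of_nat]) simp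
      ultimately show "\<forall>\<^sub>F n in sequentially. (\<sigma> \<circ> r) n \<in> bloch \<beta> \<and> bloch_dist \<beta> ((\<sigma> \<circ> r) n) (T k) < \<epsilon>"
      proof eventually_elim
        case (elim n)
        have "inverse (real (Suc (r n))) \<le> inverse (real (Suc n))"
          using strict_mono_imp_increasing[OF r, of n] by simp
        then have "bloch_dist \<beta> (\<sigma> (r n)) (T (f (r n))) < \<epsilon> / 2"
          using f(3)[of "r n"] elim(2) by linarith
        then show ?case
          using B.triangle[OF f(2) TfD Tk, of "r n" "r n"] elim(1) f(2)[of "r n"] by simp
      qed
    qed
    ultimately show "\<exists>l r. l \<in> ?cl \<and> strict_mono r \<and> limitin B.mtopology (\<sigma> \<circ> r) l sequentially"
      using r by blast
  qed
qed

lemma compact_iff_D_decay: "compact_operator \<alpha> \<beta> T \<longleftrightarrow> D_decay"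
  using D_decay_imp_compact compact_imp_test_decay test_decay_imp_D_decay by blast

lemma compact_iff_test_decay: "compact_operator \<alpha> \<beta> T \<longleftrightarrow> test_decay"
  using D_decay_imp_compact compact_imp_test_decay test_decay_imp_D_decay by blast

lemma compact_iff_power_decay: "compact_operator \<alpha> \<beta> T \<longleftrightarrow> power_decay"
  using compact_imp_power_decay power_decay_imp_test_decay compact_iff_test_decay by blast

section \<open>From epsilon conditions to the limits of the theorem\<close>

lemma D_decay_iff:
  "D_decay \<longleftrightarrow>
    ((\<lambda>r. SUP z\<in>{z\<in>unit_disk. cmod (\<phi> z) > r}.
        ennreal (cmod (Dg z) * pseudo_hyp \<phi> \<psi> z)) \<longlongrightarrow> 0) (at_left 1) \<and>
    ((\<lambda>r. SUP z\<in>{z\<in>unit_disk. cmod (\<psi> z) > r}.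
        ennreal (cmod (Dh z) * pseudo_hyp \<phi> \<psi> z)) \<longlongrightarrow> 0) (at_left 1) \<and>
    ((\<lambda>r. SUP z\<in>{z\<in>unit_disk. cmod (\<phi> z) > r \<and> cmod (\<psi> z) > r}.
        ennreal (cmod (Dg z - Dh z))) \<longlongrightarrow> 0) (at_left 1)" (is "_ \<longleftrightarrow> ?A \<and> ?B \<and> ?C")
proof -
  let ?X = "\<lambda>z. cmod (Dg z) * pdist (\<phi> z) (\<psi> z)" and ?Y = "\<lambda>z. cmod (Dh z) * pdist (\<phi> z) (\<psi> z)"
  have A: "?A \<longleftrightarrow> (\<forall>\<epsilon>>0. \<exists>r<1. \<forall>z\<in>unit_disk. cmod (\<phi> z) > r \<longrightarrow> ?X z \<le> \<epsilon>)"
    by (subst tendsto_SUP_at_left_1_iff, force)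
       (simp add: Ball_def imp_conjL pseudo_hyp_def pdist_def)
  have B: "?B \<longleftrightarrow> (\<forall>\<epsilon>>0. \<exists>r<1. \<forall>z\<in>unit_disk. cmod (\<psi> z) > r \<longrightarrow> ?Y z \<le> \<epsilon>)"
    by (subst tendsto_SUP_at_left_1_iff, force)
       (simp add: Ball_def imp_conjL pseudo_hyp_def pdist_def)
  have C: "?C \<longleftrightarrow> (\<forall>\<epsilon>>0. \<exists>r<1. \<forall>z\<in>unit_disk.
      cmod (\<phi> z) > r \<and> cmod (\<psi> z) > r \<longrightarrow> cmod (Dg z - Dh z) \<le> \<epsilon>)"
    by (subst tendsto_SUP_at_left_1_iff, force) (simp add: Ball_def imp_conjL)
  show ?thesis
  proof
    assume D_decay
    have "\<exists>r<1. \<forall>z\<in>unit_disk. (cmod (\<phi> z) > r \<longrightarrow> ?X z \<le> \<epsilon>) \<and> (cmod (\<psi> z) > r \<longrightarrow> ?Y z \<le> \<epsilon>) \<and>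
        (cmod (\<phi> z) > r \<and> cmod (\<psi> z) > r \<longrightarrow> cmod (Dg z - Dh z) \<le> \<epsilon>)" if "\<epsilon> > 0" for \<epsilon>
      using \<open>D_decay\<close> that unfolding D_decay_def by simp
    then show "?A \<and> ?B \<and> ?C"
      unfolding A B C by (intro conjI allI impI) (fast+)
  next
    assume *: "?A \<and> ?B \<and> ?C"
    show D_decay
      unfolding D_decay_def
    proof (intro allI impI)
      fix \<epsilon> :: real assume "\<epsilon> > 0"
      obtain r1 where r1: "r1 < 1" and 1: "\<forall>z\<in>unit_disk. cmod (\<phi> z) > r1 \<longrightarrow> ?X z \<le> \<epsilon>"
        using conjunct1[OF *] \<open>\<epsilon> > 0\<close> unfolding A by blast
      obtain r2 where r2: "r2 < 1" and 2: "\<forall>z\<in>unit_disk. cmod (\<psi> z) > r2 \<longrightarrow> ?Y z \<le> \<epsilon>"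
        using conjunct1[OF conjunct2[OF *]] \<open>\<epsilon> > 0\<close> unfolding B by blast
      obtain r3 where r3: "r3 < 1" and
        3: "\<forall>z\<in>unit_disk. cmod (\<phi> z) > r3 \<and> cmod (\<psi> z) > r3 \<longrightarrow> cmod (Dg z - Dh z) \<le> \<epsilon>"
        using conjunct2[OF conjunct2[OF *]] \<open>\<epsilon> > 0\<close> unfolding C by blast
      \<comment> \<open>The largest of the three radii serves, since enlarging r only weakens each
        condition.\<close>
      show "\<exists>r<1. \<forall>z\<in>unit_disk. (cmod (\<phi> z) > r \<longrightarrow> ?X z \<le> \<epsilon>) \<and> (cmod (\<psi> z) > r \<longrightarrow> ?Y z \<le> \<epsilon>) \<and>
          (cmod (\<phi> z) > r \<and> cmod (\<psi> z) > r \<longrightarrow> cmod (Dg z - Dh z) \<le> \<epsilon>)"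
        by (rule exI[of _ "max r1 (max r2 r3)"]) (use r1 r2 r3 1 2 3 in simp)
    qed
  qed
qed

lemma test_decay_iff:
  "test_decay \<longleftrightarrow>
    Limsup to_circle (\<lambda>a. ennreal (bloch_norm \<beta> (T (test_f \<alpha> a)))) = 0 \<and>
    Limsup to_circle (\<lambda>a. ennreal (bloch_norm \<beta> (T (test_g \<alpha> a)))) = 0"
proof -
  have D: "\<forall>\<^sub>F a in to_circle. a \<in> unit_disk"
    unfolding eventually_to_circle by (intro exI[of _ 0]) auto
  have f: "\<forall>\<^sub>F a in to_circle. 0 \<le> bloch_norm \<beta> (T (test_f \<alpha> a))"
    using D by eventually_elim (intro bloch_norm_nonneg T_bloch test_f_bloch(1))
  have g: "\<forall>\<^sub>F a in to_circle. 0 \<le> bloch_norm \<beta> (T (test_g \<alpha> a))"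
    using D by eventually_elim (intro bloch_norm_nonneg T_bloch test_g_bloch(1))
  show ?thesis
    unfolding Limsup_ennreal_eq_0_iff[OF to_circle_neq_bot f]
      Limsup_ennreal_eq_0_iff[OF to_circle_neq_bot g] test_decay_def eventually_conj_iff
    by blast
qed

lemma power_decay_iff:
  "power_decay \<longleftrightarrow> limsup (\<lambda>n. SUP z\<in>unit_disk.
      ennreal ((real n + 1) powr \<alpha> * (1 - (cmod z)\<^sup>2) powr \<beta>
        * cmod (\<phi> z ^ n * g z - \<psi> z ^ n * h z))) = 0"
  by (subst limsup_SUP_ennreal_eq_0_iff) (auto simp: power_decay_def wdiff_def mult.assoc)

end

theorem corollary4p5:
  fixes \<alpha> \<beta> :: real and \<phi> \<psi> g h :: "complex \<Rightarrow> complex"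
  assumes "0 < \<alpha>" and "0 < \<beta>"
    and "self_map \<phi>" and "self_map \<psi>"
    and "g holomorphic_on unit_disk" and "h holomorphic_on unit_disk"
    and "bounded_operator \<alpha> \<beta> (gen_comp \<phi> g)"
    and "bounded_operator \<alpha> \<beta> (gen_comp \<psi> h)"
  shows "let
      i = compact_operator \<alpha> \<beta> (gen_comp \<phi> g - gen_comp \<psi> h);
      ii = ((\<lambda>r. SUP z\<in>{z\<in>unit_disk. cmod (\<phi> z) > r}.
                ennreal (cmod (D_quot \<alpha> \<beta> \<phi> g z) * pseudo_hyp \<phi> \<psi> z)) \<longlongrightarrow> 0) (at_left 1)
         \<and> ((\<lambda>r. SUP z\<in>{z\<in>unit_disk. cmod (\<psi> z) > r}.
                ennreal (cmod (D_quot \<alpha> \<beta> \<psi> h z) * pseudo_hyp \<phi> \<psi> z)) \<longlongrightarrow> 0) (at_left 1)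
         \<and> ((\<lambda>r. SUP z\<in>{z\<in>unit_disk. cmod (\<phi> z) > r \<and> cmod (\<psi> z) > r}.
                ennreal (cmod (D_quot \<alpha> \<beta> \<phi> g z - D_quot \<alpha> \<beta> \<psi> h z))) \<longlongrightarrow> 0) (at_left 1);
      iii = (Limsup to_circle
                (\<lambda>a. ennreal (bloch_norm \<beta> ((gen_comp \<phi> g - gen_comp \<psi> h) (test_f \<alpha> a)))) = 0
         \<and> Limsup to_circle
                (\<lambda>a. ennreal (bloch_norm \<beta> ((gen_comp \<phi> g - gen_comp \<psi> h) (test_g \<alpha> a)))) = 0);
      iv = (limsup (\<lambda>n. SUP z\<in>unit_disk.
                ennreal ((real n + 1) powr \<alpha> * (1 - (cmod z)\<^sup>2) powr \<beta>
                  * cmod (\<phi> z ^ n * g z - \<psi> z ^ n * h z))) = 0)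
    in (i \<longleftrightarrow> ii) \<and> (i \<longleftrightarrow> iii) \<and> (i \<longleftrightarrow> iv)"
proof -
  interpret bloch_symbols \<alpha> \<beta> \<phi> \<psi> g h
    by standard (use assms in auto)
  show ?thesis
    unfolding Let_def D_decay_iff[symmetric] test_decay_iff[symmetric] power_decay_iff[symmetric]
    by (intro conjI compact_iff_D_decay compact_iff_test_decay compact_iff_power_decay)
qed

end
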